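(* Let $(\mu_k)_{k\in\mathbb{Z}}$ be a bi-sequence in $M^1(\mathbb{R}^d)$ and let $\phi$ be an invertible linear map of $\mathbb{R}^d$. Consider the equation $$\lambda_k=\mu_k*\phi(\lambda_{k-1}),\qquad k\in\mathbb{Z}.\tag{E}$$ Then $(\lambda_k)$ is a fundamental solution of (E) if and only if $(\lambda_k)$ is an extremal solution of (E). In particular, the set of extremal solutions of (E) is either empty or can be identified with $\mathbb{R}^d$.
   Context: $M^1(\mathbb{R}^d)$ is the space of Borel probability measures on $\mathbb{R}^d$; $*$ is convolution, and $\phi(\nu)$ is the image (push-forward) of $\nu$ under $\phi$. A solution of (E) is a bi-sequence $(\lambda_k)_{k\in\mathbb{Z}}$ in $M^1(\mathbb{R}^d)$ satisfying (E) for all $k\in\mathbb{Z}$. A solution $(\lambda_k)$ is fundamental if for each solution $(\nu_k)$ of (E) there is $\nu\in M^1(\mathbb{R}^d)$ such that $\nu_k=\lambda_k*\phi^k(\nu)$ for all $k\in\mathbb{Z}$. The set of all solutions is convex (with coordinatewise convex combinations); an extremal solution is an extreme point of this convex set. *)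

theory Defs
  imports "HOL-Probability.Probability"
begin

definition borel_probs :: "'a::topological_space measure set" where
  "borel_probs = {M. prob_space M \<and> sets M = sets borel}"

text \<open>\<open>int_iterate f k\<close> is the iterate of \<open>f\<close> with integer exponent \<open>k\<close>; it is meant for bijective \<open>f\<close>.\<close>

definition int_iterate :: "('a \<Rightarrow> 'a) \<Rightarrow> int \<Rightarrow> 'a \<Rightarrow> 'a" where
  "int_iterate f k = (if 0 \<le> k then f ^^ nat k else inv f ^^ nat (- k))"

definition solutions ::
  "(int \<Rightarrow> 'a::ordered_euclidean_space measure) \<Rightarrow> ('a \<Rightarrow> 'a) \<Rightarrow> (int \<Rightarrow> 'a measure) set" where
  "solutions \<mu> \<phi> = {L. (\<forall>k. L k \<in> borel_probs) \<and>
     (\<forall>k. L k = (\<mu> k \<star> distr (L (k - 1)) borel \<phi>))}"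

definition fundamental_solution ::
  "(int \<Rightarrow> 'a::ordered_euclidean_space measure) \<Rightarrow> ('a \<Rightarrow> 'a) \<Rightarrow> (int \<Rightarrow> 'a measure) \<Rightarrow> bool" where
  "fundamental_solution \<mu> \<phi> L \<longleftrightarrow> L \<in> solutions \<mu> \<phi> \<and>
     (\<forall>N \<in> solutions \<mu> \<phi>. \<exists>\<nu> \<in> borel_probs.
        \<forall>k. N k = (L k \<star> distr \<nu> borel (int_iterate \<phi> k)))"

text \<open>There is no vector space structure on the type of measures, so the coordinatewise convex
  combination \<open>L = (1 - t) P + t Q\<close> of bi-sequences of probability measures is expressed
  by its values on Borel sets.\<close>

definition convex_comb_of ::
  "(int \<Rightarrow> 'a::topological_space measure) \<Rightarrow> real \<Rightarrow> (int \<Rightarrow> 'a measure) \<Rightarrow> (int \<Rightarrow> 'a measure) \<Rightarrow> bool" where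
  "convex_comb_of L t P Q \<longleftrightarrow>
     (\<forall>k. \<forall>A \<in> sets borel.
        measure (L k) A = (1 - t) * measure (P k) A + t * measure (Q k) A)"

definition extremal_solution ::
  "(int \<Rightarrow> 'a::ordered_euclidean_space measure) \<Rightarrow> ('a \<Rightarrow> 'a) \<Rightarrow> (int \<Rightarrow> 'a measure) \<Rightarrow> bool" where
  "extremal_solution \<mu> \<phi> L \<longleftrightarrow> L \<in> solutions \<mu> \<phi> \<and>
     (\<forall>P \<in> solutions \<mu> \<phi>. \<forall>Q \<in> solutions \<mu> \<phi>. \<forall>t. 0 < t \<and> t < 1 \<and> convex_comb_of L t P Q \<longrightarrow> P = Q)"

end

theory Submission
  imports Defs "HOL-Library.Diagonal_Subsequence"
begin

text \<open>
  If \<open>F\<close> is fundamental, every extremal solution \<open>L\<close> is \<open>F\<close> translated by a measure \<open>\<nu>\<close>; conditioning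
  \<open>\<nu>\<close> on small balls around a point \<open>x\<close> of its support does not change \<open>L\<close>, so \<open>L\<close> is \<open>F\<close> translated
  by the point mass at \<open>x\<close> and is itself fundamental. Conversely, fundamental solutions are extremal
  because \<open>L \<star> \<nu> = L\<close> forces \<open>\<nu>\<close> to be the point mass at 0 (characteristic functions).

  A fundamental solution exists as soon as there is a solution at all: after the change of variables
  that turns \<open>\<phi>\<close> into the identity, the products of the \<open>\<mu>\<close>s over the indices \<open>1 - n, \<dots>, k\<close> are tight
  in \<open>n\<close> up to translations not depending on \<open>k\<close>, and one takes limits along a diagonal subsequence.
  Compactness of tight sequences in \<open>\<real>\<^sup>d\<close> is reduced to Helly's and Skorohod's theorems on the line
  by coding points as reals.
\<close>

section \<open>Probability measures on Borel sets and their weak limits\<close>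

text \<open>The only source of compactness is one given solution \<open>L\<close>: whatever the
  starting index, the partial product up to \<open>k\<close> convolved with \<open>L\<close> at the
  start gives the fixed law \<open>L k\<close>. Factors of a fixed law are tight after suitable
  translations. The translation \<open>y n\<close> of the partial product ending at 0 serves all
  \<open>k\<close>, and the compensating translation by \<open>- y n\<close> is put on the value of
  a solution \<open>N\<close> at the start. Every solution thus factors as
  \<open>N k = A k n \<star> D N n\<close>, where \<open>A\<close> does not involve \<open>N\<close>
  and \<open>D N n\<close> does not involve \<open>k\<close>. Tightness passes from
  \<open>A 0\<close> to \<open>D N\<close> for every \<open>N\<close>, and from \<open>D L\<close>
  to \<open>A k\<close> for every \<open>k\<close>. In the limit the recursion for \<open>A\<close>
  yields a solution \<open>F\<close>, and the factorization yields
  \<open>N k = F k \<star> \<nu>\<close> with one \<open>\<nu>\<close> for all \<open>k\<close>,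
  which is what fundamental means. Conditioning \<open>\<nu>\<close> on a ball and on its complement
  splits \<open>L\<close> into two solutions; extremality makes them equal, which is why
  conditioning does not change \<open>L\<close>.\<close>

lemma borel_probsD:
  assumes "M \<in> borel_probs"
  shows "prob_space M" "finite_measure M" "sets M = sets borel" "space M = UNIV"
  using assms sets_eq_imp_space_eq[of M borel]
  by (auto simp: borel_probs_def prob_space_def)

lemma distr_borel_probs:
  assumes "M \<in> borel_probs" and f: "f \<in> borel_measurable borel"
  shows "distr M borel f \<in> borel_probs"
proof -
  have "f \<in> measurable M borel"
    using f measurable_cong_sets[OF borel_probsD(3)[OF assms(1)] refl] by blast
  then show ?thesis
    using assms(1) by (simp add: borel_probs_def prob_space.prob_space_distr)
qed

lemma return_borel_probs: "return borel x \<in> borel_probs"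
  by (simp add: borel_probs_def prob_space_return)

lemma convolution_borel_probs:
  fixes M N :: "'a::ordered_euclidean_space measure"
  assumes "M \<in> borel_probs" "N \<in> borel_probs"
  shows "(M \<star> N) \<in> borel_probs"
proof -
  note [measurable_cong] = borel_probsD(3)[OF assms(1)] borel_probsD(3)[OF assms(2)]
  interpret M: prob_space M using assms(1) by (simp add: borel_probsD)
  interpret N: prob_space N using assms(2) by (simp add: borel_probsD)
  interpret pair_prob_space M N ..
  have "prob_space (M \<star> N)"
    unfolding convolution_def by (intro P.prob_space_distr) measurable
  then show ?thesis by (simp add: borel_probs_def)
qed

lemma borel_probs_commute:
  fixes M N :: "'a::ordered_euclidean_space measure"
  assumes "M \<in> borel_probs" "N \<in> borel_probs"
  shows "(M \<star> N) = (N \<star> M)"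
  using assms by (intro convolution_commutative) (simp_all add: borel_probsD)

lemma borel_probs_assoc:
  fixes L M N :: "'a::ordered_euclidean_space measure"
  assumes "L \<in> borel_probs" "M \<in> borel_probs" "N \<in> borel_probs"
  shows "((L \<star> M) \<star> N) = (L \<star> (M \<star> N))"
  using assms by (intro convolution_associative[symmetric]) (simp_all add: borel_probsD)

lemma borel_probs_eqI:
  assumes "M \<in> borel_probs" "N \<in> borel_probs"
    and "\<And>A. A \<in> sets borel \<Longrightarrow> emeasure M A = emeasure N A"
  shows "M = N"
  using assms by (intro measure_eqI) (simp_all add: borel_probsD)

lemma convolution_return:
  fixes M :: "'a::ordered_euclidean_space measure"
  assumes M: "M \<in> borel_probs"
  shows "(M \<star> return borel x) = distr M borel (\<lambda>y. y + x)"
proof (rule borel_probs_eqI)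
  note [measurable_cong] = borel_probsD(3)[OF M]
  fix A :: "'a set" assume [measurable]: "A \<in> sets borel"
  have "emeasure (M \<star> return borel x) A = (\<integral>\<^sup>+ y. \<integral>\<^sup>+ z. indicator A (y + z) \<partial>return borel x \<partial>M)"
    using M return_borel_probs[of x] by (intro convolution_emeasure') (auto simp: borel_probsD)
  also have "\<dots> = (\<integral>\<^sup>+ y. indicator A (y + x) \<partial>M)"
    by (intro nn_integral_cong) (simp add: nn_integral_return)
  also have "\<dots> = emeasure (distr M borel (\<lambda>y. y + x)) A"
    by (simp add: nn_integral_distr flip: nn_integral_indicator)
  finally show "emeasure (M \<star> return borel x) A = emeasure (distr M borel (\<lambda>y. y + x)) A" .
qed (auto intro!: convolution_borel_probs distr_borel_probs M return_borel_probs)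

lemma convolution_return_0:
  fixes M :: "'a::ordered_euclidean_space measure"
  assumes "M \<in> borel_probs"
  shows "(M \<star> return borel 0) = M"
  using convolution_return[OF assms, of 0] distr_id2[of borel M] assms
  by (simp add: borel_probsD)

lemma distr_return_borel:
  assumes "f \<in> borel_measurable borel"
  shows "distr (return borel x) borel f = return borel (f x)"
  using assms by (intro distr_return) simp_all

lemma return_convolution_return:
  fixes x y :: "'a::ordered_euclidean_space"
  shows "(return borel x \<star> return borel y) = return borel (x + y)"
  by (simp add: convolution_return return_borel_probs distr_return_borel)

lemma return_borel_inject:
  fixes x y :: "'a::t1_space"
  assumes "return borel x = return borel y"
  shows "x = y"
proof -
  have "measure (return borel x) {x} = measure (return borel y) {x}"
    using assms by simp
  then show ?thesis
    by (simp add: measure_return indicator_def split: if_splits)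
qed

lemma linear_borel_measurable:
  fixes f :: "'a::euclidean_space \<Rightarrow> 'b::euclidean_space"
  assumes "linear f"
  shows "f \<in> borel_measurable borel"
  using assms by (intro borel_measurable_continuous_onI linear_continuous_on) (simp add: linear_conv_bounded_linear)

lemma distr_convolution_linear:
  fixes M N :: "'a::ordered_euclidean_space measure"
    and f :: "'a \<Rightarrow> 'b::ordered_euclidean_space"
  assumes M: "M \<in> borel_probs" and N: "N \<in> borel_probs" and f: "linear f"
  shows "distr (M \<star> N) borel f = (distr M borel f \<star> distr N borel f)"
proof -
  have [measurable]: "f \<in> borel_measurable borel"
    by (rule linear_borel_measurable[OF f])
  note [measurable_cong] = borel_probsD(3)[OF M] borel_probsD(3)[OF N]
  interpret M: prob_space M using M by (simp add: borel_probsD)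
  interpret N: prob_space N using N by (simp add: borel_probsD)
  interpret fN: prob_space "distr N borel f" by (intro N.prob_space_distr) simp
  have "(distr M borel f \<star> distr N borel f) =
      distr (distr (M \<Otimes>\<^sub>M N) (borel \<Otimes>\<^sub>M borel) (\<lambda>(x, y). (f x, f y))) borel (\<lambda>(x, y). x + y)"
    unfolding convolution_def
    by (subst pair_measure_distr) (auto simp: fN.sigma_finite_measure_axioms)
  also have "\<dots> = distr (M \<Otimes>\<^sub>M N) borel (\<lambda>(x, y). f (x + y))"
    by (subst distr_distr) (auto simp: comp_def linear_add[OF f] intro!: arg_cong[where f="distr (M \<Otimes>\<^sub>M N) borel"])
  also have "\<dots> = distr (M \<star> N) borel f"
    unfolding convolution_def by (subst distr_distr) (auto simp: comp_def intro!: distr_cong)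
  finally show ?thesis by simp
qed

lemma AE_return_imp_eq_return:
  fixes M :: "'a::t2_space measure"
  assumes M: "M \<in> borel_probs" and ae: "AE y in M. y = x"
  shows "M = return borel x"
proof (rule borel_probs_eqI[OF M return_borel_probs])
  note [measurable_cong] = borel_probsD(3)[OF M]
  interpret M: prob_space M using M by (simp add: borel_probsD)
  fix A :: "'a set" assume A [measurable]: "A \<in> sets borel"
  have "emeasure M A = (\<integral>\<^sup>+ y. indicator A y \<partial>M)" by simp
  also have "\<dots> = (\<integral>\<^sup>+ y. indicator A x \<partial>M)"
    using ae by (intro nn_integral_cong_AE) auto
  also have "\<dots> = emeasure (return borel x) A"
    by (simp add: M.emeasure_space_1)
  finally show "emeasure M A = emeasure (return borel x) A" .
qed

section \<open>Weak convergence tested on bounded continuous functions\<close>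

definition weak_lim :: "(nat \<Rightarrow> 'a::metric_space measure) \<Rightarrow> 'a measure \<Rightarrow> bool" where
  "weak_lim M L \<longleftrightarrow> (\<forall>f::'a \<Rightarrow> real. continuous_on UNIV f \<and> (\<exists>B. \<forall>x. \<bar>f x\<bar> \<le> B)
     \<longrightarrow> (\<lambda>n. integral\<^sup>L (M n) f) \<longlonglongrightarrow> integral\<^sup>L L f)"

lemma integrable_bounded_continuous:
  fixes f :: "'a::metric_space \<Rightarrow> real"
  assumes "M \<in> borel_probs" "continuous_on UNIV f" "\<And>x. \<bar>f x\<bar> \<le> B"
  shows "integrable M f"
proof -
  note [measurable_cong] = borel_probsD(3)[OF assms(1)]
  interpret prob_space M using assms(1) by (simp add: borel_probsD)
  have [measurable]: "f \<in> borel_measurable borel"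
    using assms(2) by (rule borel_measurable_continuous_onI)
  show ?thesis using assms(3) by (intro integrable_const_bound[of f B]) auto
qed

text \<open>The integrands are continuous, lie between 0 and 1, and tend pointwise to the indicator
  of \<open>S\<close>: off the closed set \<open>S\<close> the distance to it is positive, so they
  vanish for large \<open>n\<close>. Dominated convergence does the rest.\<close>

lemma measure_closed_lim:
  fixes M :: "'a::metric_space measure"
  assumes M: "M \<in> borel_probs" and S: "closed S" "S \<noteq> {}"
  shows "(\<lambda>n. \<integral>x. max 0 (1 - real n * infdist x S) \<partial>M) \<longlonglongrightarrow> measure M S"
proof -
  note [measurable_cong] = borel_probsD(3)[OF M]
  interpret prob_space M using M by (simp add: borel_probsD)
  have [measurable]: "(\<lambda>x. infdist x S) \<in> borel_measurable borel"
    by (intro borel_measurable_continuous_onI continuous_intros)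
  have [measurable]: "S \<in> sets borel" using S by simp
  have "(\<lambda>n. \<integral>x. max 0 (1 - real n * infdist x S) \<partial>M) \<longlonglongrightarrow> (\<integral>x. indicator S x \<partial>M)"
  proof (rule integral_dominated_convergence[where w="\<lambda>_. 1"])
    show "AE x in M. (\<lambda>n. max 0 (1 - real n * infdist x S)) \<longlonglongrightarrow> indicator S x"
    proof (rule AE_I2)
      fix x
      show "(\<lambda>n. max 0 (1 - real n * infdist x S)) \<longlonglongrightarrow> indicator S x"
      proof (cases "x \<in> S")
        case False
        then have d: "infdist x S > 0"
          using S in_closed_iff_infdist_zero[of S x] infdist_nonneg[of x S] by linarith
        obtain N :: nat where N: "1 < real N * infdist x S"
          using ex_less_of_nat_mult[OF d] by auto
        have "1 \<le> real n * infdist x S" if "n \<ge> N" for n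
          using N mult_right_mono[of "real N" "real n" "infdist x S"] d that by linarith
        then have "eventually (\<lambda>n. max 0 (1 - real n * infdist x S) = indicator S x) sequentially"
          using False by (intro eventually_sequentiallyI[of N]) (simp add: max_absorb1)
        then show ?thesis by (rule tendsto_eventually)
      qed (simp add: infdist_zero)
    qed
  next
    show "AE x in M. norm (max 0 (1 - real n * infdist x S)) \<le> 1" for n
      by (intro AE_I2) (simp add: infdist_nonneg)
  qed auto
  then show ?thesis by simp
qed

text \<open>Integrals of test functions determine the measure of closed sets by
  \<open>measure_closed_lim\<close>, and closed sets form an intersection-stable generator of the
  Borel sets.\<close>

lemma borel_probs_eq_of_integral_eq:
  fixes M N :: "'a::metric_space measure"
  assumes M: "M \<in> borel_probs" and N: "N \<in> borel_probs"
    and eq: "\<And>f::'a \<Rightarrow> real. continuous_on UNIV f \<Longrightarrow> (\<exists>B. \<forall>x. \<bar>f x\<bar> \<le> B) \<Longrightarrow>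
      integral\<^sup>L M f = integral\<^sup>L N f"
  shows "M = N"
proof -
  interpret M: prob_space M using M by (simp add: borel_probsD)
  interpret N: prob_space N using N by (simp add: borel_probsD)
  have cl: "measure M S = measure N S" if S: "closed S" for S :: "'a set"
  proof (cases "S = {}")
    case False
    have *: "(\<integral>x. max 0 (1 - real n * infdist x S) \<partial>M) = (\<integral>x. max 0 (1 - real n * infdist x S) \<partial>N)" for n
      by (rule eq) (auto intro!: continuous_intros exI[of _ 1] simp: infdist_nonneg)
    show ?thesis
      using measure_closed_lim[OF M S False] measure_closed_lim[OF N S False] LIMSEQ_unique
      unfolding * by blast
  qed simp
  show ?thesis
  proof (rule measure_eqI_generator_eq[where E="Collect closed" and A="\<lambda>_. UNIV" and \<Omega>=UNIV])
    show "Int_stable (Collect closed :: 'a set set)" by (auto simp: Int_stable_def)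
    show "sets M = sigma_sets UNIV (Collect closed)" "sets N = sigma_sets UNIV (Collect closed)"
      using M N by (simp_all add: borel_probsD borel_eq_closed)
    show "emeasure M X = emeasure N X" if "X \<in> Collect closed" for X
      using cl that by (simp add: M.emeasure_eq_measure N.emeasure_eq_measure)
  qed auto
qed

lemma weak_lim_unique:
  assumes "weak_lim M A" "weak_lim M B" "A \<in> borel_probs" "B \<in> borel_probs"
  shows "A = B"
  using assms unfolding weak_lim_def
  by (intro borel_probs_eq_of_integral_eq) (blast intro: LIMSEQ_unique)+

lemma weak_lim_subseq:
  assumes "weak_lim M A" "strict_mono r"
  shows "weak_lim (M \<circ> r) A"
  unfolding weak_lim_def
proof (intro allI impI)
  fix f :: "'a \<Rightarrow> real"
  assume "continuous_on UNIV f \<and> (\<exists>B. \<forall>x. \<bar>f x\<bar> \<le> B)"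
  then have "(\<lambda>n. integral\<^sup>L (M n) f) \<longlonglongrightarrow> integral\<^sup>L A f"
    using assms(1) by (simp add: weak_lim_def)
  from LIMSEQ_subseq_LIMSEQ[OF this assms(2)]
  show "(\<lambda>n. integral\<^sup>L ((M \<circ> r) n) f) \<longlonglongrightarrow> integral\<^sup>L A f" by (simp add: comp_def)
qed

lemma weak_lim_cong_ev:
  assumes "weak_lim M A" "eventually (\<lambda>n. M n = N n) sequentially"
  shows "weak_lim N A"
  unfolding weak_lim_def
proof (intro allI impI)
  fix f :: "'a \<Rightarrow> real"
  assume "continuous_on UNIV f \<and> (\<exists>B. \<forall>x. \<bar>f x\<bar> \<le> B)"
  then have "(\<lambda>n. integral\<^sup>L (M n) f) \<longlonglongrightarrow> integral\<^sup>L A f"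
    using assms(1) by (simp add: weak_lim_def)
  then show "(\<lambda>n. integral\<^sup>L (N n) f) \<longlonglongrightarrow> integral\<^sup>L A f"
    by (rule Lim_transform_eventually) (use assms(2) in eventually_elim, simp)
qed

lemma weak_lim_eventually_const:
  assumes "eventually (\<lambda>n. M n = A) sequentially"
  shows "weak_lim M A"
  unfolding weak_lim_def
  using assms by (auto intro!: tendsto_eventually elim: eventually_mono)


section \<open>Compactness of tight sequences\<close>

text \<open>Only the digits 0 and 1 are used in base 4, so the part of the expansion behind any
  digit has relative size at most 1/3. The gap left over makes digits readable by
  \<open>floor\<close> and stable under small perturbations.\<close>

definition cantor_code :: "(nat \<Rightarrow> bool) \<Rightarrow> real" where
  "cantor_code b = (\<Sum>i. of_bool (b i) * (1/4) ^ Suc i)"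

lemma summable_cantor_code: "summable (\<lambda>i. of_bool (b i) * (1/4::real) ^ Suc i)"
proof (rule summable_comparison_test')
  show "summable (\<lambda>i. (1/4::real) ^ i)" by (rule summable_geometric) simp
  show "norm (of_bool (b i) * (1/4::real) ^ Suc i) \<le> (1/4) ^ i" if "i \<ge> 0" for i
    by simp
qed

lemma cantor_code_nonneg: "0 \<le> cantor_code b"
  unfolding cantor_code_def by (intro suminf_nonneg summable_cantor_code) simp

lemma cantor_code_le: "cantor_code b \<le> 1/3"
proof -
  have "(\<lambda>i. (1/4::real) * (1/4) ^ i) sums (1/4 * (1 / (1 - 1/4)))"
    by (intro sums_mult geometric_sums) simp
  then have *: "(\<lambda>i. (1/4::real) ^ Suc i) sums (1/3)" by simp
  have "cantor_code b \<le> (\<Sum>i. (1/4::real) ^ Suc i)"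
    unfolding cantor_code_def using *
    by (intro suminf_le summable_cantor_code) (auto simp: sums_iff)
  then show ?thesis using * by (simp add: sums_iff)
qed

lemma cantor_code_step: "4 * cantor_code b = of_bool (b 0) + cantor_code (\<lambda>i. b (Suc i))"
proof -
  have "4 * cantor_code b = 4 * ((\<Sum>i. of_bool (b (Suc i)) * (1/4) ^ Suc (Suc i)) + of_bool (b 0) / 4)"
    using suminf_split_head[OF summable_cantor_code[of b]] by (simp add: cantor_code_def)
  also have "(\<Sum>i. of_bool (b (Suc i)) * (1/4) ^ Suc (Suc i)) =
      (\<Sum>i. (of_bool (b (Suc i)) * (1/4) ^ Suc i) / 4 :: real)"
    by (intro suminf_cong) simp
  also have "\<dots> = cantor_code (\<lambda>i. b (Suc i)) / 4"
    unfolding cantor_code_def by (rule suminf_divide[OF summable_cantor_code])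
  finally show ?thesis by simp
qed

text \<open>Scaling by \<open>4 ^ Suc j\<close> moves the point just behind digit \<open>j\<close>.
  In the integer part everything before that digit is a multiple of 4, so its parity is the digit;
  the rest is again a code, hence in [0, 1/3].\<close>

lemma floor_cantor_code:
  defines "y \<equiv> \<lambda>N b. of_int N + cantor_code b"
  shows "odd \<lfloor>4 ^ Suc j * y N b\<rfloor> \<longleftrightarrow> b j"
    and "4 ^ Suc j * y N b \<le> of_int \<lfloor>4 ^ Suc j * y N b\<rfloor> + 1/3"
proof -
  have "\<exists>z::int. 4 ^ Suc j * y N b = of_int z + cantor_code (\<lambda>i. b (i + Suc j)) \<and> (odd z \<longleftrightarrow> b j)"
  proof (induction j arbitrary: N b)
    case 0
    show ?case
      by (intro exI[of _ "4 * N + of_bool (b 0)"]) (simp add: y_def cantor_code_step distrib_left)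
  next
    case (Suc j)
    \<comment> \<open>The leading digit is absorbed into the integer part, which is why the
      induction must leave \<open>N\<close> and \<open>b\<close> arbitrary.\<close>
    have "4 * y N b = y (4 * N + of_bool (b 0)) (\<lambda>i. b (Suc i))"
      by (simp add: y_def cantor_code_step distrib_left)
    then have *: "4 ^ Suc (Suc j) * y N b = 4 ^ Suc j * y (4 * N + of_bool (b 0)) (\<lambda>i. b (Suc i))"
      by simp
    show ?case
      unfolding * using Suc.IH[of "4 * N + of_bool (b 0)" "\<lambda>i. b (Suc i)"] by simp
  qed
  then obtain z :: int where z: "4 ^ Suc j * y N b = of_int z + cantor_code (\<lambda>i. b (i + Suc j))"
    "odd z \<longleftrightarrow> b j" by blast
  have "\<lfloor>4 ^ Suc j * y N b\<rfloor> = z"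
    using cantor_code_nonneg[of "\<lambda>i. b (i + Suc j)"] cantor_code_le[of "\<lambda>i. b (i + Suc j)"]
    by (intro floor_unique) (use z(1) in linarith)+
  then show "odd \<lfloor>4 ^ Suc j * y N b\<rfloor> \<longleftrightarrow> b j"
    and "4 ^ Suc j * y N b \<le> of_int \<lfloor>4 ^ Suc j * y N b\<rfloor> + 1/3"
    using z cantor_code_le[of "\<lambda>i. b (i + Suc j)"] by simp_all
qed

text \<open>
  The code of \<open>x\<close> records \<open>\<lceil>norm x\<rceil>\<close> and, as base-4 digits, membership of \<open>x\<close> in the balls of a
  countable base. As digits 2 and 3 do not occur, convergence of the codes forces each digit to
  become constant.
\<close>
lemma real_code_exists:
  obtains s :: "'a::euclidean_space \<Rightarrow> real" and c :: "real \<Rightarrow> 'a"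
  where "s \<in> borel_measurable borel" "c \<in> borel_measurable borel" "\<And>x. c (s x) = x"
    "\<And>x. norm x \<le> s x" "\<And>x. s x \<le> norm x + 2"
    "\<And>X. convergent (\<lambda>n. s (X n)) \<Longrightarrow> convergent X"
proof -
  obtain D :: "'a set" where D: "countable D" "\<And>U. open U \<Longrightarrow> U \<noteq> {} \<Longrightarrow> \<exists>d\<in>D. d \<in> U"
    by (rule countable_dense_setE) blast
  have "D \<noteq> {}" using D(2)[of UNIV] by auto
  define q where "q = from_nat_into D"
  have q: "\<exists>i. dist (q i) x < e" if "e > 0" for x e
  proof -
    have "ball x e \<noteq> {}" using that by simp
    then obtain d where "d \<in> D" "d \<in> ball x e" using D(2)[OF open_ball] by blast
    moreover have "q (to_nat_on D d) = d" using D(1) \<open>d \<in> D\<close> by (simp add: q_def)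
    ultimately show ?thesis by (metis dist_commute mem_ball)
  qed
  define G where "G m i = ball (q i) (1 / real (Suc m))" for m i
  define b where "b x = (\<lambda>j. x \<in> case_prod G (prod_decode j))" for x
  define s where "s x = of_int \<lceil>norm x\<rceil> + cantor_code (b x)" for x
  have [measurable]: "Measurable.pred borel (\<lambda>x. b x j)" for j
    by (simp add: b_def G_def split: prod.split)
  have s_meas: "s \<in> borel_measurable borel"
    unfolding s_def cantor_code_def by measurable
  \<comment> \<open>Decoding at scale \<open>m\<close>: the centre of the first ball of radius
    \<open>1 / Suc m\<close> whose digit is 1. On a code \<open>s x\<close> this centre is within
    \<open>1 / Suc m\<close> of \<open>x\<close>; on other reals the value is arbitrary, and only
    measurability matters there.\<close>
  define c' where "c' m y = q (LEAST i. odd \<lfloor>4 ^ Suc (prod_encode (m, i)) * y\<rfloor>)" for m and y :: real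
  define c where "c y = lim (\<lambda>m. c' m y)" for y
  have odd_b: "odd \<lfloor>4 ^ Suc j * s x\<rfloor> \<longleftrightarrow> b x j" for j x
    unfolding s_def by (rule floor_cantor_code(1))
  have frac: "4 ^ Suc j * s x \<le> of_int \<lfloor>4 ^ Suc j * s x\<rfloor> + 1/3" for j x
    unfolding s_def by (rule floor_cantor_code(2))
  have [measurable]: "c' m \<in> borel_measurable borel" for m
    unfolding c'_def by measurable
  have c_meas: "c \<in> borel_measurable borel"
    unfolding c_def by (rule borel_measurable_lim_metric) measurable
  have cs: "c (s x) = x" for x
  proof -
    have "dist (c' m (s x)) x < 1 / real (Suc m)" for m
    proof -
      have "\<exists>i. odd \<lfloor>4 ^ Suc (prod_encode (m, i)) * s x\<rfloor>"
        using q[of "1 / real (Suc m)" x] unfolding odd_b by (simp add: b_def G_def)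
      from LeastI_ex[OF this]
      show ?thesis unfolding c'_def odd_b by (simp add: b_def G_def)
    qed
    then have "norm (c' m (s x) - x) \<le> 1 / real (Suc m)" for m
      by (simp add: dist_norm less_imp_le)
    then have "(\<lambda>m. c' m (s x) - x) \<longlonglongrightarrow> 0"
      by (intro Lim_null_comparison[OF _ LIMSEQ_Suc[OF lim_1_over_n]] always_eventually allI)
    then have "(\<lambda>m. c' m (s x)) \<longlonglongrightarrow> x" by (simp add: LIM_zero_iff)
    then show ?thesis unfolding c_def by (rule limI)
  qed
  have s_lower: "norm x \<le> s x" for x
    using cantor_code_nonneg[of "b x"] le_of_int_ceiling[of "norm x"] unfolding s_def by linarith
  have s_upper: "s x \<le> norm x + 2" for x
    using cantor_code_le[of "b x"] of_int_ceiling_le_add_one[of "norm x"] unfolding s_def by linarith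
  have conv: "convergent X" if Y: "convergent (\<lambda>n. s (X n))" for X :: "nat \<Rightarrow> 'a"
  proof -
    have "Bseq (\<lambda>n. s (X n))" by (rule convergent_imp_Bseq[OF Y])
    then obtain K where "\<And>n. norm (s (X n)) \<le> K" by (auto simp: Bseq_def)
    then have "norm (X n) \<le> K" for n using s_lower[of "X n"] by (smt (verit) real_norm_def)
    then have "bounded (range X)" by (auto intro: boundedI)
    then obtain l r where r: "strict_mono (r::nat \<Rightarrow> nat)" "(X \<circ> r) \<longlonglongrightarrow> l"
      using bounded_imp_convergent_subsequence by blast
    have const: "\<exists>N. \<forall>n\<ge>N. \<forall>k\<ge>N. b (X n) j \<longleftrightarrow> b (X k) j" for j
    proof -
      have "Cauchy (\<lambda>n. s (X n))" using Y by (rule convergent_Cauchy)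
      \<comment> \<open>After scaling by \<open>4 ^ Suc j\<close> the codes differ by less than 1/2,
        whereas different floors would keep them at least 2/3 apart, since fractional parts do not
        exceed 1/3.\<close>
      then obtain N where N: "\<And>n k. n \<ge> N \<Longrightarrow> k \<ge> N \<Longrightarrow> dist (s (X n)) (s (X k)) < 1 / (2 * 4 ^ Suc j)"
        using metric_CauchyD[of "\<lambda>n. s (X n)" "1 / (2 * 4 ^ Suc j)"] by auto
      have "b (X n) j \<longleftrightarrow> b (X k) j" if "n \<ge> N" "k \<ge> N" for n k
      proof -
        have "\<bar>s (X n) - s (X k)\<bar> * (4 ^ Suc j) < 1/2"
          using N[OF that] by (simp add: dist_real_def field_simps)
        moreover have "\<bar>K * s (X n) - K * s (X k)\<bar> = \<bar>s (X n) - s (X k)\<bar> * K" if "K \<ge> 0" for K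
          using that by (simp add: abs_mult flip: right_diff_distrib)
        ultimately have "\<bar>4 ^ Suc j * s (X n) - 4 ^ Suc j * s (X k)\<bar> < 1/2" by simp
        then have "\<lfloor>4 ^ Suc j * s (X n)\<rfloor> = \<lfloor>4 ^ Suc j * s (X k)\<rfloor>"
          using frac[of j "X n"] frac[of j "X k"]
            of_int_floor_le[of "4 ^ Suc j * s (X n)"] of_int_floor_le[of "4 ^ Suc j * s (X k)"]
          by linarith
        then show ?thesis using odd_b by metis
      qed
      then show ?thesis by blast
    qed
    \<comment> \<open>So far \<open>l\<close> is only the limit of a subsequence. A small ball of
      the base containing \<open>l\<close> is entered along that subsequence, and as its digit is
      eventually constant, all late \<open>X k\<close> lie in it.\<close>
    have "X \<longlonglongrightarrow> l"
    proof (rule metric_LIMSEQ_I)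
      fix e :: real assume "e > 0"
      then obtain m where m: "2 / real (Suc m) < e"
        using nat_approx_posE[of "e/2"] by (auto simp: field_simps)
      obtain i where i: "dist (q i) l < 1 / real (Suc m)"
        using q[of "1 / real (Suc m)" l] by auto
      have bG: "b x (prod_encode (m, i)) \<longleftrightarrow> x \<in> G m i" for x by (simp add: b_def)
      obtain N where N: "\<And>n k. n \<ge> N \<Longrightarrow> k \<ge> N \<Longrightarrow> X n \<in> G m i \<longleftrightarrow> X k \<in> G m i"
        using const[of "prod_encode (m, i)"] unfolding bG by blast
      have "eventually (\<lambda>n. (X \<circ> r) n \<in> G m i) sequentially"
        using i by (intro topological_tendstoD[OF r(2)]) (simp_all add: G_def)
      then have "eventually (\<lambda>n. n \<ge> N \<and> X (r n) \<in> G m i) sequentially"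
        using eventually_ge_at_top[of N] by eventually_elim simp
      then obtain n where n: "n \<ge> N" "X (r n) \<in> G m i"
        using eventually_happens trivial_limit_sequentially by blast
      have "r n \<ge> N" using seq_suble[OF r(1), of n] n(1) by linarith
      then have XG: "X k \<in> G m i" if "k \<ge> N" for k using N[of "r n" k] n(2) that by blast
      have "dist (X k) l < e" if "k \<ge> N" for k
      proof -
        have "dist (q i) (X k) < 1 / real (Suc m)"
          using XG[OF that] by (simp add: G_def)
        then have "dist (X k) l < 1 / real (Suc m) + 1 / real (Suc m)"
          using i dist_triangle3[of "X k" l "q i"] by linarith
        then show ?thesis using m by simp
      qed
      then show "\<exists>N. \<forall>k\<ge>N. dist (X k) l < e" by blast
    qed
    then show ?thesis by (rule convergentI)
  qed
  show thesis by (rule that[OF s_meas c_meas cs s_lower s_upper conv])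
qed

section \<open>Tight sequences, almost surely convergent realisations, limits of
  convolutions\<close>

definition tight_seq :: "(nat \<Rightarrow> 'a::real_normed_vector measure) \<Rightarrow> bool" where
  "tight_seq M \<longleftrightarrow> (\<forall>n. M n \<in> borel_probs) \<and>
     (\<forall>e>0. \<exists>R. \<forall>n. measure (M n) (cball 0 R) \<ge> 1 - e)"

lemma tight_seq_subseq: "tight_seq M \<Longrightarrow> tight_seq (M \<circ> r)"
  unfolding tight_seq_def by fastforce

text \<open>The images under the code \<open>s\<close> are tight on the line, so Helly's theorem
  gives a subsequence and Skorohod's theorem convergent real variables \<open>Y n\<close>, which are
  decoded by \<open>c\<close>. The map \<open>c\<close> is only measurable; convergence of
  \<open>X n\<close> comes instead from the fact that convergent codes have convergent
  preimages.\<close>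

lemma tight_seq_Skorohod:
  fixes M :: "nat \<Rightarrow> 'a::euclidean_space measure"
  assumes M: "tight_seq M"
  obtains r and \<Omega> :: "real measure" and X X0 where
    "strict_mono (r::nat \<Rightarrow> nat)" "prob_space \<Omega>" "\<And>n. X n \<in> borel_measurable \<Omega>" "X0 \<in> borel_measurable \<Omega>"
    "\<And>n. distr \<Omega> borel (X n) = M (r n)" "AE w in \<Omega>. (\<lambda>n. X n w) \<longlonglongrightarrow> X0 w"
proof -
  obtain s :: "'a \<Rightarrow> real" and c where [measurable]: "s \<in> borel_measurable borel" "c \<in> borel_measurable borel"
    and cs: "\<And>x. c (s x) = x" and s_lower: "\<And>x. norm x \<le> s x" and s_upper: "\<And>x. s x \<le> norm x + 2"
    and conv: "\<And>X. convergent (\<lambda>n. s (X n)) \<Longrightarrow> convergent X"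
    by (rule real_code_exists) blast
  have Mn: "M n \<in> borel_probs" for n using M by (simp add: tight_seq_def)
  note [measurable_cong] = borel_probsD(3)[OF Mn]
  define \<mu> where "\<mu> n = distr (M n) borel s" for n
  have \<mu>: "real_distribution (\<mu> n)" for n
    unfolding \<mu>_def
    using Mn[of n] by (intro prob_space.real_distribution_distr) (simp_all add: borel_probsD)
  have "tight \<mu>"
    unfolding tight_def
  proof (intro conjI allI impI \<mu>)
    fix e :: real assume "e > 0"
    then obtain R where R: "\<And>n. measure (M n) (cball 0 R) \<ge> 1 - e/2"
      using M unfolding tight_seq_def by (meson half_gt_zero)
    \<comment> \<open>The interval contains the codes of the ball because
      \<open>0 \<le> norm x \<le> s x \<le> norm x + 2\<close>.\<close>
    have "measure (\<mu> n) {-1<..\<bar>R\<bar> + 2} > 1 - e" for n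
    proof -
      interpret Mn: prob_space "M n" using Mn[of n] by (simp add: borel_probsD)
      have "cball 0 R \<subseteq> s -` {-1<..\<bar>R\<bar> + 2}"
      proof
        fix x :: 'a assume "x \<in> cball 0 R"
        then show "x \<in> s -` {-1<..\<bar>R\<bar> + 2}"
          using s_lower[of x] s_upper[of x] norm_ge_zero[of x]
          by (simp only: mem_cball_0 vimage_eq greaterThanAtMost_iff) linarith
      qed
      then have "measure (M n) (cball 0 R) \<le> measure (M n) (s -` {-1<..\<bar>R\<bar> + 2})"
        using Mn[of n] measurable_sets_borel[of s borel "{-1<..\<bar>R\<bar> + 2}"]
        by (intro Mn.finite_measure_mono) (simp_all add: borel_probsD)
      also have "\<dots> = measure (\<mu> n) {-1<..\<bar>R\<bar> + 2}"
        using Mn[of n] by (simp add: \<mu>_def measure_distr borel_probsD)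
      finally show ?thesis using R[of n] \<open>e > 0\<close> by linarith
    qed
    then show "\<exists>a b. a < b \<and> (\<forall>n. measure (\<mu> n) {a<..b} > 1 - e)"
      by (intro exI[of _ "-1"] exI[of _ "\<bar>R\<bar> + 2"]) auto
  qed
  then obtain r N where r: "strict_mono (r::nat \<Rightarrow> nat)" and N: "real_distribution N" "weak_conv_m (\<mu> \<circ> r) N"
    using tight_imp_convergent_subsubsequence[of \<mu> id] by (auto simp: strict_mono_id)
  obtain \<Omega> :: "real measure" and Y Y0 where \<Omega>: "prob_space \<Omega>"
    and [measurable]: "\<And>n. Y n \<in> borel_measurable \<Omega>" and Y: "\<And>n. distr \<Omega> borel (Y n) = \<mu> (r n)"
    and Y_lim: "\<And>w. w \<in> space \<Omega> \<Longrightarrow> (\<lambda>n. Y n w) \<longlonglongrightarrow> Y0 w"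
    using Skorohod[of "\<mu> \<circ> r" N] \<mu> N unfolding comp_apply by metis
  define X where "X n w = c (Y n w)" for n w
  have X_meas [measurable]: "X n \<in> borel_measurable \<Omega>" for n unfolding X_def by measurable
  have distr_X: "distr \<Omega> borel (X n) = M (r n)" for n
  proof -
    have "distr \<Omega> borel (X n) = distr (distr \<Omega> borel (Y n)) borel c"
      by (simp add: distr_distr X_def[abs_def] comp_def)
    also have "\<dots> = distr (M (r n)) borel (\<lambda>x. x)"
      unfolding Y \<mu>_def by (simp add: distr_distr comp_def cs)
    also have "\<dots> = M (r n)"
      using Mn by (intro distr_id2) (simp add: borel_probsD)
    finally show ?thesis .
  qed
  have "AE w in \<Omega>. s (X n w) = Y n w" for n
  proof -
    have "AE y in distr \<Omega> borel (Y n). s (c y) = y"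
      unfolding Y \<mu>_def by (subst AE_distr_iff) (auto simp: cs)
    then show ?thesis by (subst (asm) AE_distr_iff) (auto simp: X_def)
  qed
  then have "AE w in \<Omega>. \<forall>n. s (X n w) = Y n w" by (simp add: AE_all_countable)
  then have X_lim: "AE w in \<Omega>. (\<lambda>n. X n w) \<longlonglongrightarrow> lim (\<lambda>n. X n w)"
    using AE_space
  proof eventually_elim
    case (elim w)
    then have "(\<lambda>n. s (X n w)) \<longlonglongrightarrow> Y0 w" using Y_lim by simp
    then show ?case using conv[of "\<lambda>n. X n w"] by (simp add: convergentI flip: convergent_LIMSEQ_iff)
  qed
  have "(\<lambda>w. lim (\<lambda>n. X n w)) \<in> borel_measurable \<Omega>"
    by (rule borel_measurable_lim_metric) simp
  from that[OF r \<Omega> X_meas this distr_X X_lim] show thesis .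
qed

lemma weak_lim_of_AE_lim:
  fixes X :: "nat \<Rightarrow> 'b \<Rightarrow> 'a::metric_space"
  assumes "prob_space \<Omega>" and [measurable]: "\<And>n. X n \<in> borel_measurable \<Omega>" "X0 \<in> borel_measurable \<Omega>"
    and lim: "AE w in \<Omega>. (\<lambda>n. X n w) \<longlonglongrightarrow> X0 w"
  shows "weak_lim (\<lambda>n. distr \<Omega> borel (X n)) (distr \<Omega> borel X0)"
  unfolding weak_lim_def
proof (intro allI impI, elim conjE exE)
  fix f :: "'a \<Rightarrow> real" and B
  assume f: "continuous_on UNIV f" and B: "\<forall>x. \<bar>f x\<bar> \<le> B"
  interpret prob_space \<Omega> by fact
  have [measurable]: "f \<in> borel_measurable borel"
    using f by (rule borel_measurable_continuous_onI)
  have "(\<lambda>n. \<integral>w. f (X n w) \<partial>\<Omega>) \<longlonglongrightarrow> (\<integral>w. f (X0 w) \<partial>\<Omega>)"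
  proof (rule integral_dominated_convergence[where w="\<lambda>_. B"])
    show "AE w in \<Omega>. (\<lambda>n. f (X n w)) \<longlonglongrightarrow> f (X0 w)"
      using lim
    proof eventually_elim
      case (elim w)
      with f show ?case by (auto simp: continuous_on_eq_continuous_at intro: isCont_tendsto_compose)
    qed
  qed (use B in auto)
  then show "(\<lambda>n. integral\<^sup>L (distr \<Omega> borel (X n)) f) \<longlonglongrightarrow> integral\<^sup>L (distr \<Omega> borel X0) f"
    by (simp add: integral_distr)
qed

lemma tight_seq_weak_lim:
  fixes M :: "nat \<Rightarrow> 'a::euclidean_space measure"
  assumes M: "tight_seq M"
  obtains r L where "strict_mono (r::nat \<Rightarrow> nat)" "L \<in> borel_probs" "weak_lim (M \<circ> r) L"
proof -
  obtain r and \<Omega> :: "real measure" and X X0 where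
    *: "strict_mono (r::nat \<Rightarrow> nat)" "prob_space \<Omega>" "\<And>n. X n \<in> borel_measurable \<Omega>" "X0 \<in> borel_measurable \<Omega>"
    "\<And>n. distr \<Omega> borel (X n) = M (r n)" "AE w in \<Omega>. (\<lambda>n. X n w) \<longlonglongrightarrow> X0 w"
    by (rule tight_seq_Skorohod[OF M]) blast
  have "weak_lim (M \<circ> r) (distr \<Omega> borel X0)"
    using weak_lim_of_AE_lim[OF *(2,3,4,6)] by (simp add: *(5) comp_def)
  moreover have "distr \<Omega> borel X0 \<in> borel_probs"
    using *(2,4) by (simp add: borel_probs_def prob_space.prob_space_distr)
  ultimately show thesis using that *(1) by blast
qed

lemma (in sigma_finite_measure) AE_pair_fst:
  assumes "AE x in N. P x"
  shows "AE w in N \<Otimes>\<^sub>M M. P (fst w)"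
proof -
  obtain Z where Z: "Z \<in> null_sets N" "{x \<in> space N. \<not> P x} \<subseteq> Z"
    using assms by (auto simp: eventually_ae_filter)
  then show ?thesis
    by (intro AE_I'[of "Z \<times> space M"]) (auto simp: space_pair_measure)
qed

lemma (in sigma_finite_measure) AE_pair_snd:
  assumes "AE y in M. P y"
  shows "AE w in N \<Otimes>\<^sub>M M. P (snd w)"
proof -
  obtain Z where Z: "Z \<in> null_sets M" "{x \<in> space M. \<not> P x} \<subseteq> Z"
    using assms by (auto simp: eventually_ae_filter)
  then show ?thesis
    by (intro AE_I'[of "space N \<times> Z"]) (auto simp: space_pair_measure)
qed

lemma distr_pair_add:
  fixes f g :: "'c \<Rightarrow> 'a::ordered_euclidean_space"
  assumes "prob_space M" "prob_space N"
    and [measurable]: "f \<in> borel_measurable M" "g \<in> borel_measurable N"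
  shows "distr (M \<Otimes>\<^sub>M N) borel (\<lambda>w. f (fst w) + g (snd w)) = (distr M borel f \<star> distr N borel g)"
proof -
  interpret gN: prob_space "distr N borel g"
    using assms by (intro prob_space.prob_space_distr) simp_all
  have "(distr M borel f \<star> distr N borel g) =
      distr (distr (M \<Otimes>\<^sub>M N) (borel \<Otimes>\<^sub>M borel) (\<lambda>(x, y). (f x, g y))) borel (\<lambda>(x, y). x + y)"
    unfolding convolution_def
    by (subst pair_measure_distr) (auto simp: gN.sigma_finite_measure_axioms)
  also have "\<dots> = distr (M \<Otimes>\<^sub>M N) borel (\<lambda>w. f (fst w) + g (snd w))"
    by (subst distr_distr) (auto simp: comp_def case_prod_beta)
  finally show ?thesis by simp
qed

text \<open>Both factors are realised as almost surely convergent variables; on the product space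
  the sums converge almost surely, and their laws are the convolutions. The equation need only hold
  eventually, as the partial products below obey their recursion only for late starting
  indices.\<close>

lemma weak_lim_convolution_unique:
  fixes A B C :: "nat \<Rightarrow> 'a::ordered_euclidean_space measure"
  assumes A: "tight_seq A" "weak_lim A a" and B: "tight_seq B" "weak_lim B b" and C: "weak_lim C c"
    and a: "a \<in> borel_probs" and b: "b \<in> borel_probs" and c: "c \<in> borel_probs"
    and eq: "eventually (\<lambda>n. C n = (A n \<star> B n)) sequentially"
  shows "c = (a \<star> b)"
proof -
  obtain r and \<Omega> :: "real measure" and X X0 where r: "strict_mono (r::nat \<Rightarrow> nat)"
    and X: "prob_space \<Omega>" "\<And>n. X n \<in> borel_measurable \<Omega>" "X0 \<in> borel_measurable \<Omega>"
    "AE w in \<Omega>. (\<lambda>n. X n w) \<longlonglongrightarrow> X0 w" and distr_X: "\<And>n. distr \<Omega> borel (X n) = A (r n)"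
    by (rule tight_seq_Skorohod[OF A(1)]) blast
  \<comment> \<open>The second extraction is made along \<open>r\<close>, so that both sequences
    converge along the common subsequence \<open>t\<close>.\<close>
  obtain r' and \<Omega>' :: "real measure" and Y Y0 where r': "strict_mono (r'::nat \<Rightarrow> nat)"
    and Y: "prob_space \<Omega>'" "\<And>n. Y n \<in> borel_measurable \<Omega>'" "Y0 \<in> borel_measurable \<Omega>'"
    "AE w in \<Omega>'. (\<lambda>n. Y n w) \<longlonglongrightarrow> Y0 w" and distr_Y: "\<And>n. distr \<Omega>' borel (Y n) = B (r (r' n))"
    by (rule tight_seq_Skorohod[OF tight_seq_subseq[OF B(1), of r], unfolded comp_apply]) blast
  define t where "t = r \<circ> r'"
  have t: "strict_mono t" unfolding t_def by (intro strict_mono_o r r')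
  interpret \<Omega>: prob_space \<Omega> by fact
  interpret \<Omega>': prob_space \<Omega>' by fact
  interpret pair_prob_space \<Omega> \<Omega>' ..
  note [measurable] = X(2,3) Y(2,3)
  have distr_X0: "distr \<Omega> borel X0 = a"
  proof (rule weak_lim_unique)
    show "weak_lim (A \<circ> r) (distr \<Omega> borel X0)"
      using weak_lim_of_AE_lim[OF X] by (simp add: distr_X comp_def)
  qed (use a in \<open>simp_all add: weak_lim_subseq A r borel_probs_def \<Omega>.prob_space_distr\<close>)
  have distr_Y0: "distr \<Omega>' borel Y0 = b"
  proof (rule weak_lim_unique)
    show "weak_lim (B \<circ> t) (distr \<Omega>' borel Y0)"
      using weak_lim_of_AE_lim[OF Y] by (simp add: distr_Y comp_def t_def)
  qed (use b in \<open>simp_all add: weak_lim_subseq B t borel_probs_def \<Omega>'.prob_space_distr\<close>)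
  define Z where "Z n w = X (r' n) (fst w) + Y n (snd w)" for n w
  have Z_distr: "distr (\<Omega> \<Otimes>\<^sub>M \<Omega>') borel (Z n) = (A (t n) \<star> B (t n))" for n
    unfolding Z_def[abs_def]
    by (subst distr_pair_add) (simp_all add: X Y distr_X distr_Y t_def)
  have "AE w in \<Omega> \<Otimes>\<^sub>M \<Omega>'. (\<lambda>n. Z n w) \<longlonglongrightarrow> X0 (fst w) + Y0 (snd w)"
    using \<Omega>'.AE_pair_fst[OF X(4)] \<Omega>'.AE_pair_snd[OF Y(4)]
  proof eventually_elim
    case (elim w)
    show ?case
      unfolding Z_def using LIMSEQ_subseq_LIMSEQ[OF elim(1) r'] elim(2)
      by (intro tendsto_add) (simp_all add: comp_def)
  qed
  then have "weak_lim (\<lambda>n. distr (\<Omega> \<Otimes>\<^sub>M \<Omega>') borel (Z n))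
      (distr (\<Omega> \<Otimes>\<^sub>M \<Omega>') borel (\<lambda>w. X0 (fst w) + Y0 (snd w)))"
    by (intro weak_lim_of_AE_lim P.prob_space_axioms) (simp_all add: Z_def[abs_def])
  then have lim: "weak_lim (\<lambda>n. A (t n) \<star> B (t n)) (a \<star> b)"
    by (simp add: Z_distr distr_pair_add X Y distr_X0 distr_Y0)
  have ev: "eventually (\<lambda>n. (A (t n) \<star> B (t n)) = C (t n)) sequentially"
    using eventually_subseq[OF t eq] by eventually_elim simp
  have "weak_lim (C \<circ> t) (a \<star> b)"
    using lim by (rule weak_lim_cong_ev) (use ev in \<open>simp add: comp_def\<close>)
  then show ?thesis
    using weak_lim_subseq[OF C t] weak_lim_unique c convolution_borel_probs[OF a b] by blast
qed


section \<open>Convolution factors\<close>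

lemma exists_cball_measure_ge:
  fixes M :: "'a::euclidean_space measure"
  assumes M: "M \<in> borel_probs" and e: "e > 0"
  shows "\<exists>R. measure M (cball 0 R) \<ge> 1 - e"
proof -
  interpret prob_space M using M by (simp add: borel_probsD)
  have "(\<lambda>n. measure M (cball 0 (real n))) \<longlonglongrightarrow> measure M (\<Union>n. cball 0 (real n))"
    using M by (intro finite_Lim_measure_incseq) (auto simp: borel_probsD incseq_def)
  moreover have "(\<Union>n. cball (0::'a) (real n)) = space M"
    using M real_arch_simple by (auto simp: borel_probsD)
  ultimately have "(\<lambda>n. measure M (cball 0 (real n))) \<longlonglongrightarrow> 1"
    by (simp add: prob_space)
  then have "eventually (\<lambda>n. measure M (cball 0 (real n)) > 1 - e) sequentially"
    using e by (intro order_tendstoD(1)[of _ 1]) simp_all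
  then obtain n where "measure M (cball 0 (real n)) > 1 - e"
    using eventually_happens trivial_limit_sequentially by blast
  then show ?thesis by (intro exI[of _ "real n"]) simp
qed

lemma tight_seq_const:
  fixes M :: "'a::euclidean_space measure"
  assumes "M \<in> borel_probs"
  shows "tight_seq (\<lambda>_. M)"
  using assms exists_cball_measure_ge by (auto simp: tight_seq_def)

text \<open>For independent \<open>x\<close> and \<open>y\<close>, if \<open>x\<close> lies in the
  ball of radius \<open>R\<close> and \<open>x + y\<close> in that of radius \<open>R'\<close>, then
  \<open>y = (x + y) - x\<close> lies in the ball of radius \<open>R + R'\<close>. The exceptional
  probabilities add up.\<close>

lemma cball_measure_ge_of_convolution:
  fixes a b :: "'a::ordered_euclidean_space measure"
  assumes a: "a \<in> borel_probs" and b: "b \<in> borel_probs"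
    and "measure a (cball 0 R) \<ge> 1 - e" "measure (a \<star> b) (cball 0 R') \<ge> 1 - e'"
  shows "measure b (cball 0 (R + R')) \<ge> 1 - (e + e')"
proof -
  note [measurable_cong] = borel_probsD(3)[OF a] borel_probsD(3)[OF b]
  interpret a: prob_space a using a by (simp add: borel_probsD)
  interpret b: prob_space b using b by (simp add: borel_probsD)
  interpret pair_prob_space a b ..
  note [simp] = borel_probsD(4)[OF a] borel_probsD(4)[OF b] borel_probsD(3)[OF a] borel_probsD(3)[OF b]
  define U V W where "U = cball (0::'a) R \<times> (UNIV::'a set)"
    and "V = (\<lambda>(x, y). x + y) -` cball (0::'a) R' \<inter> space (a \<Otimes>\<^sub>M b)"
    and "W = (UNIV::'a set) \<times> cball (0::'a) (R + R')"
  have sets: "U \<in> sets (a \<Otimes>\<^sub>M b)" "V \<in> sets (a \<Otimes>\<^sub>M b)" "W \<in> sets (a \<Otimes>\<^sub>M b)"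
  proof -
    show "U \<in> sets (a \<Otimes>\<^sub>M b)" "W \<in> sets (a \<Otimes>\<^sub>M b)" by (simp_all add: U_def W_def)
    show "V \<in> sets (a \<Otimes>\<^sub>M b)" unfolding V_def by (rule measurable_sets[where A=borel]) measurable
  qed
  have U: "measure (a \<Otimes>\<^sub>M b) U = measure a (cball 0 R)"
    unfolding U_def measure_def using b.emeasure_space_1 by (simp add: b.emeasure_pair_measure_Times)
  have W: "measure (a \<Otimes>\<^sub>M b) W = measure b (cball 0 (R + R'))"
    unfolding W_def measure_def using a.emeasure_space_1 by (simp add: b.emeasure_pair_measure_Times)
  have V: "measure (a \<Otimes>\<^sub>M b) V = measure (a \<star> b) (cball 0 R')"
    unfolding V_def convolution_def by (subst measure_distr) simp_all
  have "U \<inter> V \<subseteq> W"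
  proof
    fix w assume w: "w \<in> U \<inter> V"
    obtain x y where [simp]: "w = (x, y)" by (cases w)
    have "norm y \<le> norm (x + y) + norm x" using norm_triangle_ineq4[of "x + y" x] by simp
    then show "w \<in> W" using w by (simp add: U_def V_def W_def)
  qed
  then have "measure (a \<Otimes>\<^sub>M b) (U \<inter> V) \<le> measure (a \<Otimes>\<^sub>M b) W"
    using sets by (intro P.finite_measure_mono)
  moreover have "measure (a \<Otimes>\<^sub>M b) (U \<union> V) \<le> 1" by simp
  moreover have "measure (a \<Otimes>\<^sub>M b) (U \<union> V) = measure (a \<Otimes>\<^sub>M b) U + measure (a \<Otimes>\<^sub>M b) V - measure (a \<Otimes>\<^sub>M b) (U \<inter> V)"
    using sets by (intro measure_Un3) (simp_all add: P.fmeasurable_eq_sets)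
  ultimately show ?thesis using assms(3,4) unfolding U V W by linarith
qed

lemma tight_seq_of_convolution:
  fixes A B :: "nat \<Rightarrow> 'a::ordered_euclidean_space measure"
  assumes A: "tight_seq A" and C: "tight_seq (\<lambda>n. A n \<star> B n)" and B: "\<And>n. B n \<in> borel_probs"
  shows "tight_seq B"
  unfolding tight_seq_def
proof (intro conjI allI impI B)
  fix e :: real assume "e > 0"
  then obtain R R' where "\<And>n. measure (A n) (cball 0 R) \<ge> 1 - e/2"
    "\<And>n. measure (A n \<star> B n) (cball 0 R') \<ge> 1 - e/2"
    using A C unfolding tight_seq_def by (meson half_gt_zero)
  then have "measure (B n) (cball 0 (R + R')) \<ge> 1 - (e/2 + e/2)" for n
    using A B by (intro cball_measure_ge_of_convolution[where a="A n"]) (auto simp: tight_seq_def)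
  then show "\<exists>R. \<forall>n. measure (B n) (cball 0 R) \<ge> 1 - e" by auto
qed

text \<open>
  The function \<open>h\<close> grows at infinity but is integrable for the product measure \<open>c\<close>; by Fubini some
  translate of each left factor has a uniformly bounded integral of \<open>h\<close>.
\<close>
lemma tight_seq_shift:
  fixes a b :: "nat \<Rightarrow> 'a::ordered_euclidean_space measure"
  assumes a: "\<And>n. a n \<in> borel_probs" and b: "\<And>n. b n \<in> borel_probs" and c: "c \<in> borel_probs"
    and eq: "\<And>n. (a n \<star> b n) = c"
  obtains y where "tight_seq (\<lambda>n. a n \<star> return borel (y n))"
proof -
  \<comment> \<open>The tails are chosen against the weights \<open>2 ^ m\<close> of
    \<open>h\<close>: the sum of \<open>2 ^ m * ((1/4) ^ m / 2)\<close> is 1, while the weights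
    still grow without bound.\<close>
  have "\<exists>R. measure c (cball 0 R) \<ge> 1 - (1/4) ^ m / 2" for m :: nat
    using c by (intro exists_cball_measure_ge) simp_all
  then obtain R where R: "\<And>m::nat. measure c (cball 0 (R m)) \<ge> 1 - (1/4) ^ m / 2" by metis
  interpret c: prob_space c using c by (simp add: borel_probsD)
  define h :: "'a \<Rightarrow> ennreal" where "h z = (\<Sum>m. 2 ^ m * indicator (- cball 0 (R m)) z)" for z
  have [measurable]: "- cball 0 (R m) \<in> sets borel" for m by (intro borel_comp) simp
  have h_meas [measurable]: "h \<in> borel_measurable borel" unfolding h_def by measurable
  have tail_c: "emeasure c (- cball 0 (R m)) \<le> ennreal ((1/4) ^ m / 2)" for m
  proof -
    have "measure c (- cball 0 (R m)) = 1 - measure c (cball 0 (R m))"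
      using c.prob_compl[of "cball 0 (R m)"] c by (simp add: borel_probsD Compl_eq_Diff_UNIV)
    then show ?thesis using R[of m] by (simp add: c.emeasure_eq_measure)
  qed
  have "(\<integral>\<^sup>+ z. h z \<partial>c) = (\<Sum>m. \<integral>\<^sup>+ z. 2 ^ m * indicator (- cball 0 (R m)) z \<partial>c)"
    unfolding h_def using c by (intro nn_integral_suminf) (simp add: borel_probsD cong: measurable_cong_sets)
  also have "\<dots> = (\<Sum>m. 2 ^ m * emeasure c (- cball 0 (R m)))"
    using c by (intro suminf_cong nn_integral_cmult_indicator) (simp add: borel_probsD)
  also have "\<dots> \<le> (\<Sum>m. ennreal ((1/2) ^ Suc m))"
  proof (intro suminf_le summableI)
    fix m
    have "2 ^ m * emeasure c (- cball 0 (R m)) \<le> 2 ^ m * ennreal ((1/4) ^ m / 2)"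
      by (intro mult_left_mono tail_c) simp
    also have "\<dots> = ennreal (2 ^ m) * ennreal ((1/4) ^ m / 2)" by (simp flip: ennreal_power)
    also have "\<dots> = ennreal ((1/2) ^ Suc m)"
      by (simp flip: ennreal_mult power_mult_distrib)
    finally show "2 ^ m * emeasure c (- cball 0 (R m)) \<le> ennreal ((1/2) ^ Suc m)" .
  qed
  also have "\<dots> = 1"
    using power_half_series by (subst suminf_ennreal_eq[where x=1]) simp_all
  finally have int_c: "(\<integral>\<^sup>+ z. h z \<partial>c) \<le> 1" .
  \<comment> \<open>If all translates exceeded 2, so would their average over \<open>y\<close>
    distributed as \<open>b n\<close>; but that average is the integral of \<open>h\<close> against
    \<open>c\<close>, at most 1.\<close>
  have "\<exists>y. (\<integral>\<^sup>+ x. h (x + y) \<partial>a n) \<le> 2" for n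
  proof (rule ccontr)
    assume "\<not> ?thesis"
    then have *: "2 \<le> (\<integral>\<^sup>+ x. h (y + x) \<partial>a n)" for y
      unfolding add.commute[of y] by (meson linorder_le_cases)
    interpret bn: prob_space "b n" using b by (simp add: borel_probsD)
    have "2 = (\<integral>\<^sup>+ y. 2 \<partial>b n)" by (simp add: bn.emeasure_space_1)
    also have "\<dots> \<le> (\<integral>\<^sup>+ y. \<integral>\<^sup>+ x. h (y + x) \<partial>a n \<partial>b n)"
      by (intro nn_integral_mono *)
    also have "\<dots> = (\<integral>\<^sup>+ z. h z \<partial>(b n \<star> a n))"
      using a b by (intro nn_integral_convolution[symmetric]) (auto simp: borel_probsD)
    also have "\<dots> \<le> 1"
      using int_c eq[of n] borel_probs_commute[OF a[of n] b[of n]] by simp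
    finally show False by simp
  qed
  then obtain y where y: "\<And>n. (\<integral>\<^sup>+ x. h (x + y n) \<partial>a n) \<le> 2" by metis
  have ay: "(a n \<star> return borel (y n)) \<in> borel_probs" for n
    by (intro convolution_borel_probs a return_borel_probs)
  \<comment> \<open>Markov's inequality applied to the single summand \<open>m\<close> of
    \<open>h\<close>; the bound does not depend on \<open>n\<close>.\<close>
  have tail: "measure (a n \<star> return borel (y n)) (cball 0 (R m)) \<ge> 1 - 2 * (1/2) ^ m" for n m
  proof -
    interpret N: prob_space "a n \<star> return borel (y n)" using ay by (simp add: borel_probsD)
    note [measurable_cong] = borel_probsD(3)[OF a]
    have "2 ^ m * indicator (- cball 0 (R m)) z \<le> h z" for z
      unfolding h_def using sum_le_suminf[OF summableI, of "{m}" "\<lambda>m. 2 ^ m * indicator (- cball 0 (R m)) z"]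
      by simp
    then have "(\<integral>\<^sup>+ z. 2 ^ m * indicator (- cball 0 (R m)) z \<partial>(a n \<star> return borel (y n)))
        \<le> (\<integral>\<^sup>+ z. h z \<partial>(a n \<star> return borel (y n)))"
      by (intro nn_integral_mono)
    also have "\<dots> = (\<integral>\<^sup>+ x. h (x + y n) \<partial>a n)"
      unfolding convolution_return[OF a] by (subst nn_integral_distr) simp_all
    also have "\<dots> \<le> 2" by (rule y)
    finally have "2 ^ m * emeasure (a n \<star> return borel (y n)) (- cball 0 (R m)) \<le> 2"
      by (simp add: nn_integral_cmult_indicator)
    then have "ennreal (2 ^ m * measure (a n \<star> return borel (y n)) (- cball 0 (R m))) \<le> ennreal 2"
      by (simp add: N.emeasure_eq_measure ennreal_mult flip: ennreal_power)
    then have "2 ^ m * measure (a n \<star> return borel (y n)) (- cball 0 (R m)) \<le> 2"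
      by (subst (asm) ennreal_le_iff) simp_all
    then have "measure (a n \<star> return borel (y n)) (- cball 0 (R m)) \<le> 2 * (1/2) ^ m"
      by (simp add: field_simps power_one_over)
    moreover have "measure (a n \<star> return borel (y n)) (- cball 0 (R m))
        = 1 - measure (a n \<star> return borel (y n)) (cball 0 (R m))"
      using N.prob_compl[of "cball 0 (R m)"] by (simp add: Compl_eq_Diff_UNIV)
    ultimately show ?thesis by simp
  qed
  have "tight_seq (\<lambda>n. a n \<star> return borel (y n))"
    unfolding tight_seq_def
  proof (intro conjI allI impI ay)
    fix e :: real assume "e > 0"
    then obtain m where "(1/2) ^ m < e/2"
      using real_arch_pow_inv[of "e/2" "1/2"] by auto
    then have "measure (a n \<star> return borel (y n)) (cball 0 (R m)) \<ge> 1 - e" for n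
      using tail[of m n] by linarith
    then show "\<exists>R. \<forall>n. measure (a n \<star> return borel (y n)) (cball 0 R) \<ge> 1 - e" by blast
  qed
  then show thesis by (rule that)
qed

section \<open>Characteristic functions and cancellation\<close>

lemma char_convolution:
  fixes L N :: "real measure"
  assumes L: "L \<in> borel_probs" and N: "N \<in> borel_probs"
  shows "char (L \<star> N) t = char L t * char N t"
proof -
  note [measurable_cong] = borel_probsD(3)[OF L] borel_probsD(3)[OF N]
  interpret L: prob_space L using L by (simp add: borel_probsD)
  interpret N: prob_space N using N by (simp add: borel_probsD)
  interpret pair_prob_space L N ..
  have "char (L \<star> N) t = (\<integral>w. iexp (t * (fst w + snd w)) \<partial>(L \<Otimes>\<^sub>M N))"
    unfolding char_def convolution_def by (subst integral_distr) (simp_all add: case_prod_beta)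
  also have "\<dots> = (\<integral>w. iexp (t * fst w) * iexp (t * snd w) \<partial>(L \<Otimes>\<^sub>M N))"
    by (simp add: distrib_left exp_add)
  also have "\<dots> = (\<integral>x. \<integral>y. iexp (t * x) * iexp (t * y) \<partial>N \<partial>L)"
    by (subst integral_fst'[symmetric]) (auto intro!: P.integrable_const_bound[where B=1] simp: norm_mult)
  also have "\<dots> = char L t * char N t"
    by (simp add: char_def)
  finally show ?thesis .
qed

text \<open>Characteristic functions give \<open>char L t = char L t * char N t\<close>, and
  \<open>char L\<close> does not vanish near 0, so \<open>char N\<close> equals 1 there. Knowing
  this on an interval around 0 already confines \<open>N\<close> to the origin, because
  \<open>cos (t * y) = 1\<close> for arbitrarily small nonzero \<open>t\<close> forces
  \<open>y = 0\<close>.\<close>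

lemma real_convolution_eq_self_imp:
  fixes L N :: "real measure"
  assumes L: "L \<in> borel_probs" and N: "N \<in> borel_probs" and eq: "(L \<star> N) = L"
  shows "AE y in N. y = 0"
proof -
  note [measurable_cong] = borel_probsD(3)[OF L] borel_probsD(3)[OF N]
  interpret L: real_distribution L
    using L by (simp add: real_distribution_def real_distribution_axioms_def borel_probsD)
  interpret N: real_distribution N
    using N by (simp add: real_distribution_def real_distribution_axioms_def borel_probsD)
  have "char L \<midarrow>0\<rightarrow> char L 0" using L.isCont_char[of 0] by (simp add: isCont_def)
  then have "eventually (\<lambda>t. char L t \<noteq> 0) (at 0)"
    by (rule tendsto_imp_eventually_ne) (simp add: L.char_zero)
  then obtain d where d: "d > 0" "\<And>t. t \<noteq> 0 \<Longrightarrow> \<bar>t\<bar> < d \<Longrightarrow> char L t \<noteq> 0"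
    unfolding eventually_at by (auto simp: dist_real_def)
  \<comment> \<open>The real part of \<open>char N t = 1\<close> says that the nonnegative function
    \<open>1 - cos (t * y)\<close> has integral 0.\<close>
  have cos1: "AE y in N. cos (t * y) = 1" if "t \<noteq> 0" "\<bar>t\<bar> < d" for t
  proof -
    have "char N t = 1"
      using char_convolution[OF L N, of t] d(2)[OF that] eq by simp
    then have "Re (\<integral>y. iexp (t * y) \<partial>N) = 1" by (simp add: char_def)
    also have "Re (\<integral>y. iexp (t * y) \<partial>N) = (\<integral>y. Re (iexp (t * y)) \<partial>N)"
      by (intro integral_Re[symmetric] N.integrable_const_bound[where B=1]) auto
    finally have int: "(\<integral>y. cos (t * y) \<partial>N) = 1" by (simp add: Re_exp)
    have I: "integrable N (\<lambda>y. cos (t * y))"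
      by (intro N.integrable_const_bound[where B=1]) auto
    have "(\<integral>y. 1 - cos (t * y) \<partial>N) = 0"
      using I int N.prob_space by simp
    then have "AE y in N. 1 - cos (t * y) = 0"
      using I by (subst (asm) integral_nonneg_eq_0_iff_AE) auto
    then show ?thesis by eventually_elim simp
  qed
  \<comment> \<open>A countable family of \<open>t\<close> keeps the exceptional set null;
    \<open>n + 2\<close> keeps every \<open>t\<close> nonzero and strictly below \<open>d\<close>.
    For given \<open>y\<close>, some \<open>t\<close> makes the argument smaller than 1, hence too
    small for a nonzero multiple of \<open>2 * pi\<close>.\<close>
  have "AE y in N. \<forall>n::nat. cos (d / real (n + 2) * y) = 1"
    unfolding AE_all_countable using d(1) by (intro allI cos1) (auto simp: field_simps intro: add_pos_nonneg)
  then show ?thesis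
  proof eventually_elim
    case (elim y)
    obtain n :: nat where n: "d * \<bar>y\<bar> < real n" using reals_Archimedean2 by blast
    define z where "z = d / real (n + 2) * y"
    have "\<bar>z\<bar> = d * \<bar>y\<bar> / real (n + 2)" using d(1) by (simp add: z_def abs_mult)
    also have "\<dots> < 1" using n by simp
    finally have z: "\<bar>z\<bar> < 1" .
    have "cos z = 1" unfolding z_def using elim by blast
    then obtain k :: int where k: "z = of_int k * 2 * pi" unfolding cos_one_2pi_int by blast
    have "k = 0"
    proof (rule ccontr)
      assume "k \<noteq> 0"
      then have "1 * 6 \<le> \<bar>real_of_int k\<bar> * (2 * pi)"
        using pi_gt3 by (intro mult_mono) auto
      then show False using z k by (simp add: abs_mult mult_ac)
    qed
    then show "y = 0" using k d(1) by (simp add: z_def)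
  qed
qed

text \<open>Each coordinate projection is linear and so respects convolution, which reduces the
  claim to the line.\<close>

lemma convolution_eq_self_imp:
  fixes L N :: "'a::ordered_euclidean_space measure"
  assumes L: "L \<in> borel_probs" and N: "N \<in> borel_probs" and eq: "(L \<star> N) = L"
  shows "N = return borel 0"
proof (rule AE_return_imp_eq_return[OF N])
  note [measurable_cong] = borel_probsD(3)[OF N]
  have "AE y in N. y \<bullet> i = 0" for i
  proof -
    have lin: "linear (\<lambda>y::'a. y \<bullet> i)" by (intro bounded_linear.linear bounded_linear_inner_left)
    have "AE z in distr N borel (\<lambda>y. y \<bullet> i). z = 0"
    proof (rule real_convolution_eq_self_imp)
      show "(distr L borel (\<lambda>y. y \<bullet> i) \<star> distr N borel (\<lambda>y. y \<bullet> i)) = distr L borel (\<lambda>y. y \<bullet> i)"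
        using distr_convolution_linear[OF L N lin] eq by simp
    qed (auto intro!: distr_borel_probs L N)
    then show ?thesis by (subst (asm) AE_distr_iff) auto
  qed
  then have "AE y in N. \<forall>i\<in>Basis. y \<bullet> i = 0"
    by (intro AE_finite_allI) simp_all
  then show "AE y in N. y = 0"
    by eventually_elim (simp add: euclidean_eq_iff[where 'a='a])
qed

text \<open>Otherwise every point has a null ball around it, and by Lindelof countably many null
  open sets cover the space.\<close>

lemma support_point_exists:
  fixes M :: "'a::{metric_space,second_countable_topology} measure"
  assumes M: "M \<in> borel_probs"
  obtains x where "\<And>r. r > 0 \<Longrightarrow> measure M (cball x r) > 0"
proof (rule ccontr)
  interpret prob_space M using M by (simp add: borel_probsD)
  assume "\<not> thesis"
  then have *: "\<exists>r>0. measure M (cball x r) = 0" for x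
    using that by (metis measure_nonneg order_le_less)
  define \<F> where "\<F> = {U. open U \<and> U \<in> null_sets M}"
  obtain \<F>' where F': "\<F>' \<subseteq> \<F>" "countable \<F>'" "\<Union>\<F>' = \<Union>\<F>"
    by (rule Lindelof[of \<F>]) (auto simp: \<F>_def)
  have "\<Union>\<F> = UNIV"
  proof (intro equalityI subsetI)
    fix x :: 'a
    obtain r where r: "r > 0" "measure M (cball x r) = 0" using * by blast
    then have "cball x r \<in> null_sets M" using M by (simp add: null_sets_def emeasure_eq_measure borel_probsD)
    then have "ball x r \<in> null_sets M"
      by (rule null_sets_subset) (use M in \<open>auto simp: borel_probsD\<close>)
    then show "x \<in> \<Union>\<F>" using r(1) by (auto simp: \<F>_def)
  qed simp
  moreover have "\<Union>\<F>' \<in> null_sets M"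
    using null_sets_UN'[OF F'(2), of "\<lambda>U. U" M] F'(1) by (auto simp: \<F>_def)
  ultimately have "space M \<in> null_sets M" using F'(3) M by (simp add: borel_probsD)
  then show False using emeasure_space_1 by (simp add: null_sets_def)
qed

text \<open>Applied later to images of measures conditioned on shrinking balls. Bounded radii give
  one ball carrying every \<open>B n\<close>; continuity of the test function at \<open>x\<close>
  gives the limit.\<close>

lemma concentrating_tight_weak_lim:
  fixes B :: "nat \<Rightarrow> 'a::euclidean_space measure"
  assumes B: "\<And>n. B n \<in> borel_probs" and AE: "\<And>n. AE y in B n. dist y x \<le> d n" and d: "d \<longlonglongrightarrow> 0"
  shows "tight_seq B" "weak_lim B (return borel x)"
proof -
  have "Bseq d" using d convergent_imp_Bseq convergentI by blast
  then obtain K where K: "\<And>n. norm (d n) \<le> K" by (auto simp: Bseq_def)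
  have "measure (B n) (cball 0 (norm x + K)) = 1" for n
  proof -
    interpret prob_space "B n" using B by (simp add: borel_probsD)
    have "AE y in B n. y \<in> cball 0 (norm x + K)"
      using AE[of n]
    proof eventually_elim
      case (elim y)
      then show ?case using K[of n] norm_triangle_sub[of y x] by (simp add: dist_norm)
    qed
    then show ?thesis using B by (subst prob_eq_1) (simp_all add: borel_probsD)
  qed
  then show "tight_seq B"
    unfolding tight_seq_def using B by (auto intro!: exI[of _ "norm x + K"])
  show "weak_lim B (return borel x)"
    unfolding weak_lim_def
  proof (intro allI impI, elim conjE exE)
    fix f :: "'a \<Rightarrow> real" and K assume f: "continuous_on UNIV f" and K: "\<forall>x. \<bar>f x\<bar> \<le> K"
    have [measurable]: "f \<in> borel_measurable borel"
      using f by (rule borel_measurable_continuous_onI)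
    have "(\<lambda>n. integral\<^sup>L (B n) f) \<longlonglongrightarrow> f x"
    proof (rule LIMSEQ_I)
      fix e :: real assume "e > 0"
      then have "e / 2 > 0" by simp
      then obtain \<delta> where \<delta>: "\<delta> > 0" "\<And>y. dist y x < \<delta> \<Longrightarrow> dist (f y) (f x) < e / 2"
        using f unfolding continuous_on_iff by (metis UNIV_I)
      obtain N where N: "\<And>n. n \<ge> N \<Longrightarrow> d n < \<delta>"
        using order_tendstoD(2)[OF d \<delta>(1)] by (auto simp: eventually_sequentially)
      have "norm (integral\<^sup>L (B n) f - f x) < e" if "n \<ge> N" for n
      proof -
        interpret prob_space "B n" using B by (simp add: borel_probsD)
        have I: "integrable (B n) f" using integrable_bounded_continuous[OF B f] K by blast
        have close: "AE y in B n. \<bar>f y - f x\<bar> \<le> e / 2"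
          using AE[of n]
        proof eventually_elim
          case (elim y)
          then have "dist y x < \<delta>" using N[OF that] by linarith
          then show ?case using \<delta>(2)[of y] by (simp add: dist_real_def)
        qed
        have "integral\<^sup>L (B n) f \<le> f x + e / 2"
          by (intro integral_le_const I, use close in eventually_elim) linarith
        moreover have "integral\<^sup>L (B n) f \<ge> f x - e / 2"
          by (intro integral_ge_const I, use close in eventually_elim) linarith
        ultimately show ?thesis using \<open>e > 0\<close> by (simp add: abs_less_iff)
      qed
      then show "\<exists>N. \<forall>n\<ge>N. norm (integral\<^sup>L (B n) f - f x) < e" by blast
    qed
    then show "(\<lambda>n. integral\<^sup>L (B n) f) \<longlonglongrightarrow> integral\<^sup>L (return borel x) f"
      by (simp add: integral_return)
  qed
qed


section \<open>Existence of a fundamental solution\<close>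

lemma tight_seq_if:
  assumes M: "tight_seq M" and N: "tight_seq N"
  shows "tight_seq (\<lambda>n. if P n then M n else N n)"
  unfolding tight_seq_def
proof (intro conjI allI impI)
  show "(if P n then M n else N n) \<in> borel_probs" for n
    using M N by (simp add: tight_seq_def)
  fix e :: real assume "e > 0"
  then obtain R R' where R: "\<And>n. measure (M n) (cball 0 R) \<ge> 1 - e" "\<And>n. measure (N n) (cball 0 R') \<ge> 1 - e"
    using M N unfolding tight_seq_def by meson
  have mono: "measure K (cball 0 r) \<le> measure K (cball 0 r')" if "K \<in> borel_probs" "r \<le> r'"
    for K :: "'a measure" and r r'
    using that by (intro finite_measure.finite_measure_mono subset_cball) (auto simp: borel_probsD)
  have "measure (M n) (cball 0 (max R R')) \<ge> 1 - e" "measure (N n) (cball 0 (max R R')) \<ge> 1 - e" for n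
    using R[of n] mono[of "M n" R "max R R'"] mono[of "N n" R' "max R R'"] M N
    by (auto simp: tight_seq_def intro: order_trans)
  then show "\<exists>R. \<forall>n. measure (if P n then M n else N n) (cball 0 R) \<ge> 1 - e"
    by (intro exI[of _ "max R R'"]) simp
qed

lemma weak_lim_offset:
  assumes "weak_lim (M \<circ> (+) m) L"
  shows "weak_lim M L"
  unfolding weak_lim_def
proof (intro allI impI)
  fix f :: "'a \<Rightarrow> real"
  assume "continuous_on UNIV f \<and> (\<exists>B. \<forall>x. \<bar>f x\<bar> \<le> B)"
  then have "(\<lambda>n. integral\<^sup>L (M (n + m)) f) \<longlonglongrightarrow> integral\<^sup>L L f"
    using assms by (simp add: weak_lim_def add.commute)
  then show "(\<lambda>n. integral\<^sup>L (M n) f) \<longlonglongrightarrow> integral\<^sup>L L f" by (rule LIMSEQ_offset)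
qed

text \<open>The product of \<open>\<sigma>\<close> over the indices \<open>m + 1\<close> to
  \<open>m + j\<close>. The index \<open>m\<close> is left out, so that the product carries the
  value of a solution at \<open>m\<close> to its value at \<open>m + j\<close>.\<close>

primrec partial_conv :: "(int \<Rightarrow> 'a::ordered_euclidean_space measure) \<Rightarrow> int \<Rightarrow> nat \<Rightarrow> 'a measure" where
  "partial_conv \<sigma> m 0 = return borel 0"
| "partial_conv \<sigma> m (Suc j) = (\<sigma> (m + int (Suc j)) \<star> partial_conv \<sigma> m j)"

lemma partial_conv_borel_probs:
  assumes "\<And>k. \<sigma> k \<in> borel_probs"
  shows "partial_conv \<sigma> m j \<in> borel_probs"
  by (induction j) (simp_all add: return_borel_probs convolution_borel_probs assms)

lemma partial_conv_solution:
  assumes \<sigma>: "\<And>k. \<sigma> k \<in> borel_probs" and L: "\<And>k. L k \<in> borel_probs"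
    and eq: "\<And>k. L k = (\<sigma> k \<star> L (k - 1))"
  shows "L (m + int j) = (partial_conv \<sigma> m j \<star> L m)"
proof (induction j)
  case 0
  show ?case
    using convolution_return_0[OF L] borel_probs_commute[OF L return_borel_probs] by simp
next
  case (Suc j)
  have "L (m + int (Suc j)) = (\<sigma> (m + int (Suc j)) \<star> L (m + int j))"
    using eq[of "m + int (Suc j)"] by (simp add: algebra_simps)
  also have "\<dots> = (partial_conv \<sigma> m (Suc j) \<star> L m)"
    unfolding Suc by (simp add: borel_probs_assoc \<sigma> L partial_conv_borel_probs)
  finally show ?case .
qed

text \<open>
  The partial convolutions \<open>\<sigma> k \<star> \<dots> \<star> \<sigma> (1 - n)\<close> become tight after translation by some \<open>y n\<close> not depending
  on \<open>k\<close>, and the fundamental solution is their limit along a common subsequence.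
\<close>
lemma fundamental_exists_id:
  fixes \<sigma> L :: "int \<Rightarrow> 'a::ordered_euclidean_space measure"
  assumes \<sigma>: "\<And>k. \<sigma> k \<in> borel_probs" and L: "\<And>k. L k \<in> borel_probs"
    and L_eq: "\<And>k. L k = (\<sigma> k \<star> L (k - 1))"
  obtains F where "\<And>k. F k \<in> borel_probs" "\<And>k. F k = (\<sigma> k \<star> F (k - 1))"
    "\<And>N. (\<And>k. N k \<in> borel_probs) \<Longrightarrow> (\<And>k. N k = (\<sigma> k \<star> N (k - 1))) \<Longrightarrow>
      \<exists>\<nu>\<in>borel_probs. \<forall>k. N k = (F k \<star> \<nu>)"
proof -
  define \<eta> where "\<eta> n k = partial_conv \<sigma> (- int n) (nat (k + int n))" for n k
  have \<eta>: "\<eta> n k \<in> borel_probs" for n k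
    unfolding \<eta>_def by (rule partial_conv_borel_probs[OF \<sigma>])
  have \<eta>_sol: "N k = (\<eta> n k \<star> N (- int n))"
    if "\<And>k. N k \<in> borel_probs" "\<And>k. N k = (\<sigma> k \<star> N (k - 1))" "- int n \<le> k" for N n k
    using partial_conv_solution[of \<sigma> N "- int n" "nat (k + int n)", OF \<sigma> that(1,2)] that(3)
    by (simp add: \<eta>_def)
  have \<eta>_step: "\<eta> n k = (\<sigma> k \<star> \<eta> n (k - 1))" if "- int n < k" for n k
  proof -
    have "nat (k + int n) = Suc (nat (k - 1 + int n))" using that by simp
    then show ?thesis using that by (simp add: \<eta>_def)
  qed
  have "(\<eta> n 0 \<star> L (- int n)) = L 0" for n
    using \<eta>_sol[OF L L_eq, of n 0] by simp
  then obtain y where y: "tight_seq (\<lambda>n. \<eta> n 0 \<star> return borel (y n))"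
    by (rule tight_seq_shift[OF \<eta> L L])
  \<comment> \<open>One shift \<open>y n\<close> for all \<open>k\<close> preserves the recursion in
    \<open>k\<close>. \<open>D\<close> carries the opposite shift, so
    \<open>A k n \<star> D N n\<close> is \<open>N k\<close>. The point mass for the finitely many
    \<open>n\<close> starting beyond \<open>k\<close> is a harmless default.\<close>
  define A where "A k n = (if - int n \<le> k then (\<eta> n k \<star> return borel (y n)) else return borel 0)" for k n
  define D where "D N n = (N (- int n) \<star> return borel (- y n))" for N n
  have A: "A k n \<in> borel_probs" for k n
    by (simp add: A_def \<eta> return_borel_probs convolution_borel_probs)
  have D: "D N n \<in> borel_probs" if "\<And>k. N k \<in> borel_probs" for N n
    by (simp add: D_def that return_borel_probs convolution_borel_probs)
  have AD: "(A k n \<star> D N n) = N k"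
    if N: "\<And>k. N k \<in> borel_probs" "\<And>k. N k = (\<sigma> k \<star> N (k - 1))" and "- int n \<le> k" for N n k
  proof -
    let ?y = "return borel (y n)" and ?y' = "return borel (- y n)"
    have "(A k n \<star> D N n) = (\<eta> n k \<star> (?y \<star> (N (- int n) \<star> ?y')))"
      using that(3) by (simp add: A_def D_def N(1) borel_probs_assoc \<eta> return_borel_probs convolution_borel_probs)
    also have "(?y \<star> (N (- int n) \<star> ?y')) = ((N (- int n) \<star> ?y') \<star> ?y)"
      by (intro borel_probs_commute convolution_borel_probs return_borel_probs N)
    also have "\<dots> = (N (- int n) \<star> (?y' \<star> ?y))"
      by (intro borel_probs_assoc return_borel_probs N)
    also have "\<dots> = N (- int n)"
      by (simp add: return_convolution_return convolution_return_0 N(1))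
    finally show ?thesis using \<eta>_sol[OF N that(3)] by simp
  qed
  have D_tight: "tight_seq (D N)"
    if N: "\<And>k. N k \<in> borel_probs" "\<And>k. N k = (\<sigma> k \<star> N (k - 1))" for N
  proof (rule tight_seq_of_convolution)
    \<comment> \<open>For \<open>k = 0\<close> the default of \<open>A\<close> never applies, so the
      choice of \<open>y\<close> gives this directly.\<close>
    show "tight_seq (A 0)" using y by (simp add: A_def[abs_def])
    show "tight_seq (\<lambda>n. A 0 n \<star> D N n)"
      using tight_seq_const[OF N(1)] by (simp add: AD[where N=N, OF N])
  qed (rule D[OF N(1)])
  have A_tight: "tight_seq (A k)" for k
  proof (rule tight_seq_of_convolution)
    show "tight_seq (D L)" by (rule D_tight[OF L L_eq])
    \<comment> \<open>Tightness of \<open>A k\<close> for arbitrary \<open>k\<close> comes from the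
      known solution \<open>L\<close>: the other factor \<open>D L\<close> is tight, and the product
      is the constant \<open>L k\<close> apart from the default cases.\<close>
    have "(D L n \<star> A k n) = (if - int n \<le> k then L k else D L n)" for n
    proof (cases "- int n \<le> k")
      case True
      then show ?thesis
        using AD[where N=L and n=n and k=k, OF L L_eq] borel_probs_commute[OF D[where N=L, OF L] A] by simp
    next
      case False
      then show ?thesis
        using convolution_return_0[OF D[where N=L and n=n, OF L]] by (simp add: A_def)
    qed
    then show "tight_seq (\<lambda>n. D L n \<star> A k n)"
      using tight_seq_if[OF tight_seq_const[OF L[of k]] D_tight[OF L L_eq]] by simp
  qed (rule A)
  \<comment> \<open>The integers are enumerated by \<open>from_nat\<close>, so that the diagonal
    argument handles all \<open>k\<close> at once.\<close>
  define P where "P i s \<longleftrightarrow> (\<exists>F\<in>borel_probs. weak_lim (A (from_nat i) \<circ> s) F)" for i s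
  interpret subseqs P
  proof
    fix i and s :: "nat \<Rightarrow> nat" assume "strict_mono s"
    obtain r F where "strict_mono (r::nat \<Rightarrow> nat)" "F \<in> borel_probs" "weak_lim (A (from_nat i) \<circ> s \<circ> r) F"
      by (rule tight_seq_weak_lim[OF tight_seq_subseq[OF A_tight]])
    then show "\<exists>r. strict_mono r \<and> P i (s \<circ> r)"
      by (auto simp: P_def comp_assoc)
  qed
  define d where "d = diagseq"
  have d: "strict_mono d" unfolding d_def by (rule subseq_diagseq)
  have "\<exists>F\<in>borel_probs. weak_lim (A k \<circ> d) F" for k
  proof -
    \<comment> \<open>The diagonal sequence is a subsequence of the one extracted for a given index
      only after finitely many terms; \<open>weak_lim_offset\<close> removes this shift.\<close>
    have "P (to_nat k) (diagseq \<circ> ((+) (Suc (to_nat k))))"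
    proof (rule diagseq_holds)
      show "P i (s \<circ> r)" if "strict_mono r" "P i s" for r s i
        using that weak_lim_subseq[of "A (from_nat i) \<circ> s" _ r] by (auto simp: P_def comp_assoc)
    qed
    then obtain F where "F \<in> borel_probs" "weak_lim ((A k \<circ> d) \<circ> ((+) (Suc (to_nat k)))) F"
      by (auto simp: P_def d_def comp_assoc)
    then show ?thesis using weak_lim_offset by blast
  qed
  then obtain F where F: "\<And>k. F k \<in> borel_probs" and F_lim: "\<And>k. weak_lim (A k \<circ> d) (F k)"
    by metis
  have F_eq: "F k = (\<sigma> k \<star> F (k - 1))" for k
  proof (rule weak_lim_convolution_unique)
    show "weak_lim (A k \<circ> d) (F k)" "weak_lim (A (k - 1) \<circ> d) (F (k - 1))" by (rule F_lim)+
    show "tight_seq (\<lambda>_. \<sigma> k)" by (rule tight_seq_const[OF \<sigma>])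
    show "weak_lim (\<lambda>_. \<sigma> k) (\<sigma> k)" by (rule weak_lim_eventually_const) simp
    show "tight_seq (A (k - 1) \<circ> d)" by (rule tight_seq_subseq[OF A_tight])
    show "\<forall>\<^sub>F n in sequentially. (A k \<circ> d) n = (\<sigma> k \<star> (A (k - 1) \<circ> d) n)"
    \<comment> \<open>\<open>Suc\<close> secures the strict inequality
      \<open>- int (d n) < k\<close>, so that neither \<open>A k\<close> nor
      \<open>A (k - 1)\<close> takes its default value.\<close>
    proof (rule eventually_sequentiallyI[of "Suc (nat (- k))"])
      fix n assume "Suc (nat (- k)) \<le> n"
      then have "- int (d n) < k" using seq_suble[OF d, of n] by linarith
      then show "(A k \<circ> d) n = (\<sigma> k \<star> (A (k - 1) \<circ> d) n)"
        using \<eta>_step[of "d n" k] by (simp add: A_def borel_probs_assoc \<sigma> \<eta> return_borel_probs)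
    qed
  qed (rule F \<sigma>)+
  have "\<exists>\<nu>\<in>borel_probs. \<forall>k. N k = (F k \<star> \<nu>)"
    if N: "\<And>k. N k \<in> borel_probs" "\<And>k. N k = (\<sigma> k \<star> N (k - 1))" for N
  proof -
    \<comment> \<open>\<open>D N\<close> does not involve \<open>k\<close>, so this one limit
      \<open>\<nu>\<close> serves every coordinate.\<close>
    obtain r \<nu> where r: "strict_mono (r::nat \<Rightarrow> nat)" and \<nu>: "\<nu> \<in> borel_probs" "weak_lim (D N \<circ> d \<circ> r) \<nu>"
      by (rule tight_seq_weak_lim[OF tight_seq_subseq[OF D_tight[OF N]]])
    have "N k = (F k \<star> \<nu>)" for k
    proof (rule weak_lim_convolution_unique)
      show "weak_lim (A k \<circ> d \<circ> r) (F k)" by (rule weak_lim_subseq[OF F_lim r])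
      show "weak_lim (D N \<circ> d \<circ> r) \<nu>" by (rule \<nu>)
      show "weak_lim (\<lambda>_. N k) (N k)" by (rule weak_lim_eventually_const) simp
      show "tight_seq (A k \<circ> d \<circ> r)" "tight_seq (D N \<circ> d \<circ> r)"
        by (intro tight_seq_subseq A_tight D_tight N)+
      show "\<forall>\<^sub>F n in sequentially. N k = ((A k \<circ> d \<circ> r) n \<star> (D N \<circ> d \<circ> r) n)"
      proof (rule eventually_sequentiallyI[of "nat (- k)"])
        fix n assume "nat (- k) \<le> n"
        then have "- int (d (r n)) \<le> k"
          using seq_suble[OF d, of "r n"] seq_suble[OF r, of n] by linarith
        from AD[where N=N, OF N this] show "N k = ((A k \<circ> d \<circ> r) n \<star> (D N \<circ> d \<circ> r) n)" by simp
      qed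
    qed (rule F N \<nu>)+
    with \<nu> show ?thesis by blast
  qed
  with F F_eq show thesis by (rule that)
qed

section \<open>Integer iterates of a linear bijection\<close>

lemma int_iterate_0 [simp]: "int_iterate f 0 = id"
  by (simp add: int_iterate_def)

lemma int_iterate_plus_1:
  assumes "bij f"
  shows "int_iterate f (k + 1) = f \<circ> int_iterate f k" "int_iterate f (k + 1) = int_iterate f k \<circ> f"
proof -
  have inv: "f \<circ> inv f = id" "inv f \<circ> f = id"
    using assms by (simp_all add: bij_def flip: surj_iff)
  have "int_iterate f (k + 1) = f \<circ> int_iterate f k \<and> int_iterate f (k + 1) = int_iterate f k \<circ> f"
  proof (cases "k \<ge> 0")
    case True
    then have "nat (k + 1) = Suc (nat k)" by simp
    then show ?thesis using True by (simp add: int_iterate_def funpow_Suc_right[symmetric] del: funpow.simps)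
       (simp add: funpow_Suc_right)
  next
    case False
    define m where "m = nat (- (k + 1))"
    have m: "int_iterate f k = inv f ^^ Suc m" "int_iterate f (k + 1) = inv f ^^ m"
      using False by (auto simp: int_iterate_def m_def Suc_nat_eq_nat_zadd1 simp del: funpow.simps)
    have "f \<circ> (inv f ^^ Suc m) = inv f ^^ m"
      using inv(1) by (simp flip: comp_assoc)
    moreover have "(inv f ^^ Suc m) \<circ> f = inv f ^^ m"
      unfolding funpow_Suc_right comp_assoc inv(2) by simp
    ultimately show ?thesis unfolding m by simp
  qed
  then show "int_iterate f (k + 1) = f \<circ> int_iterate f k" "int_iterate f (k + 1) = int_iterate f k \<circ> f"
    by blast+
qed

lemma int_iterate_minus:
  assumes "bij f"
  shows "int_iterate f k \<circ> int_iterate f (- k) = id"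
proof -
  have step: "int_iterate f (i + 1) \<circ> int_iterate f (- (i + 1)) = int_iterate f i \<circ> int_iterate f (- i)" for i
    using int_iterate_plus_1(2)[OF assms, of i] int_iterate_plus_1(1)[OF assms, of "- (i + 1)"]
    by (simp add: comp_assoc)
  show ?thesis
  proof (induction k rule: int_induct[where k=0])
    case (step2 i)
    then show ?case using step[of "i - 1"] by (metis diff_add_cancel)
  qed (simp_all only: step int_iterate_0 minus_zero id_comp)
qed

lemma linear_funpow:
  fixes f :: "'a::real_normed_vector \<Rightarrow> 'a"
  assumes "linear f"
  shows "linear (f ^^ n)"
proof (induction n)
  case 0
  show ?case using bounded_linear.linear[OF bounded_linear_ident] by (simp add: id_def)
next
  case (Suc n)
  then show ?case using linear_compose[of "f ^^ n" f] assms by (simp only: funpow.simps)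
qed

lemma linear_int_iterate:
  fixes f :: "'a::euclidean_space \<Rightarrow> 'a"
  assumes "linear f" "bij f"
  shows "linear (int_iterate f k)"
proof -
  have "linear (inv f)"
    using assms by (intro bounded_linear.linear inj_linear_imp_inv_bounded_linear)
      (simp_all add: linear_conv_bounded_linear bij_is_inj)
  then show ?thesis using assms by (simp add: int_iterate_def linear_funpow)
qed

lemma distr_borel_probs_distr:
  assumes "M \<in> borel_probs" "f \<in> borel_measurable borel" "g \<in> borel_measurable borel"
  shows "distr (distr M borel f) borel g = distr M borel (g \<circ> f)"
  using assms measurable_cong_sets[OF borel_probsD(3)[OF assms(1)] refl]
  by (intro distr_distr) auto

lemma distr_borel_probs_id:
  assumes "M \<in> borel_probs"
  shows "distr M borel id = M"
  using assms distr_id2[of borel M] by (simp add: borel_probsD id_def)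

section \<open>Extremal solutions\<close>

text \<open>Stated with \<open>emeasure\<close> so that nonnegative integration preserves it without
  integrability conditions; for probability measures and weights in [0, 1] it agrees with the
  real-valued form in \<open>convex_comb_of\<close>.\<close>

definition mixture_of :: "'a::topological_space measure \<Rightarrow> real \<Rightarrow> 'a measure \<Rightarrow> 'a measure \<Rightarrow> bool" where
  "mixture_of M t P Q \<longleftrightarrow> (\<forall>A\<in>sets borel. emeasure M A = ennreal (1 - t) * emeasure P A + ennreal t * emeasure Q A)"

lemma mixture_of_iff_measure:
  assumes "M \<in> borel_probs" "P \<in> borel_probs" "Q \<in> borel_probs" "0 \<le> t" "t \<le> 1"
  shows "mixture_of M t P Q \<longleftrightarrow>
    (\<forall>A\<in>sets borel. measure M A = (1 - t) * measure P A + t * measure Q A)"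
  using assms
  by (simp add: mixture_of_def borel_probsD finite_measure.emeasure_eq_measure
      flip: ennreal_mult ennreal_plus)

lemma mixture_exists:
  assumes P: "P \<in> borel_probs" and Q: "Q \<in> borel_probs" and t: "0 \<le> t" "t \<le> 1"
  shows "\<exists>M\<in>borel_probs. mixture_of M t P Q"
proof -
  define m where "m A = ennreal (1 - t) * emeasure P A + ennreal t * emeasure Q A" for A
  define M where "M = measure_of UNIV (sets borel) m"
  have sets_M: "sets M = sets borel"
    unfolding M_def by (simp add: sets.sigma_sets_eq[of borel, simplified])
  have em: "emeasure M A = m A" if "A \<in> sets borel" for A
  proof (rule emeasure_measure_of[OF M_def])
    show "positive (sets M) m" by (simp add: positive_def m_def)
    show "countably_additive (sets M) m"
    proof (rule countably_additiveI)
      fix S :: "nat \<Rightarrow> _" assume S: "range S \<subseteq> sets M" "disjoint_family S"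
      have "(\<Sum>i. m (S i)) = ennreal (1 - t) * (\<Sum>i. emeasure P (S i)) + ennreal t * (\<Sum>i. emeasure Q (S i))"
        unfolding m_def by (simp add: suminf_add[symmetric] summableI)
      also have "\<dots> = m (\<Union>i. S i)"
        unfolding m_def using S P Q by (simp add: suminf_emeasure sets_M borel_probsD)
      finally show "(\<Sum>i. m (S i)) = m (\<Union>i. S i)" .
    qed
  qed (use that sets_M in auto)
  have "emeasure M UNIV = 1"
    using prob_space.emeasure_space_1[OF borel_probsD(1)[OF P]] prob_space.emeasure_space_1[OF borel_probsD(1)[OF Q]]
      P Q t
    by (simp add: em m_def borel_probsD flip: ennreal_plus)
  then have "M \<in> borel_probs"
    using sets_M sets_eq_imp_space_eq[OF sets_M] by (auto simp: borel_probs_def intro: prob_spaceI)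
  then show ?thesis using em by (auto simp: mixture_of_def m_def)
qed

lemma mixture_of_distr:
  assumes "M \<in> borel_probs" "P \<in> borel_probs" "Q \<in> borel_probs" "mixture_of M t P Q" "f \<in> borel_measurable borel"
  shows "mixture_of (distr M borel f) t (distr P borel f) (distr Q borel f)"
  unfolding mixture_of_def
proof
  fix A :: "'b set" assume A: "A \<in> sets borel"
  have "emeasure (distr K borel f) A = emeasure K (f -` A)" if "K \<in> borel_probs" for K
    using that assms(5) A measurable_cong_sets[OF borel_probsD(3)[OF that] refl]
    by (subst emeasure_distr) (auto simp: borel_probsD)
  then show "emeasure (distr M borel f) A =
      ennreal (1 - t) * emeasure (distr P borel f) A + ennreal t * emeasure (distr Q borel f) A"
    using assms A measurable_sets_borel[OF assms(5) A] by (simp add: mixture_of_def)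
qed

text \<open>Convolution with a fixed \<open>K\<close> is affine: it integrates the measures of
  translates of a set against \<open>K\<close>.\<close>

lemma mixture_of_convolution:
  fixes K M P Q :: "'a::ordered_euclidean_space measure"
  assumes K: "K \<in> borel_probs" and M: "M \<in> borel_probs" and P: "P \<in> borel_probs" and Q: "Q \<in> borel_probs"
    and mix: "mixture_of M t P Q"
  shows "mixture_of (K \<star> M) t (K \<star> P) (K \<star> Q)"
  unfolding mixture_of_def
proof
  fix A :: "'a set" assume A [measurable]: "A \<in> sets borel"
  note [measurable_cong] = borel_probsD(3)[OF K] borel_probsD(3)[OF P] borel_probsD(3)[OF Q]
  interpret P: prob_space P using P by (simp add: borel_probsD)
  interpret Q: prob_space Q using Q by (simp add: borel_probsD)
  have conv: "emeasure (K \<star> N) A = (\<integral>\<^sup>+ x. emeasure N {y. y + x \<in> A} \<partial>K)" if "N \<in> borel_probs" for N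
    using that K by (intro convolution_emeasure A) (simp_all add: borel_probsD)
  have shift: "{y. y + x \<in> A} \<in> sets borel" for x by measurable
  have [measurable]: "(\<lambda>x. emeasure P {y. y + x \<in> A}) \<in> borel_measurable K"
    "(\<lambda>x. emeasure Q {y. y + x \<in> A}) \<in> borel_measurable K"
    using P Q by (auto intro!: P.measurable_emeasure Q.measurable_emeasure simp: borel_probsD)
  show "emeasure (K \<star> M) A = ennreal (1 - t) * emeasure (K \<star> P) A + ennreal t * emeasure (K \<star> Q) A"
    using mix shift unfolding conv[OF M] conv[OF P] conv[OF Q] mixture_of_def
    by (simp add: nn_integral_add nn_integral_cmult)
qed

lemma mixture_of_unique:
  assumes "M \<in> borel_probs" "N \<in> borel_probs" "mixture_of M t P Q" "mixture_of N t P Q"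
  shows "M = N"
  using assms by (intro borel_probs_eqI) (simp_all add: mixture_of_def)

lemma mixture_of_self:
  assumes "0 \<le> t" "t \<le> 1"
  shows "mixture_of M t M M"
  using assms by (simp add: mixture_of_def flip: distrib_right ennreal_plus)

text \<open>Point masses are extreme: the complement of \<open>x\<close> is null for the mixture,
  hence for both components, whose weights are positive.\<close>

lemma mixture_of_return_imp:
  fixes P Q :: "'a::t2_space measure"
  assumes P: "P \<in> borel_probs" and Q: "Q \<in> borel_probs"
    and mix: "mixture_of (return borel x) t P Q" and t: "0 < t" "t < 1"
  shows "P = return borel x" "Q = return borel x"
proof -
  have "- {x} \<in> sets borel" by (intro borel_comp) simp
  then have "ennreal (1 - t) * emeasure P (- {x}) + ennreal t * emeasure Q (- {x}) =
      emeasure (return borel x) (- {x})"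
    using mix unfolding mixture_of_def by metis
  also have "\<dots> = 0" using \<open>- {x} \<in> sets borel\<close> by simp
  finally have "ennreal (1 - t) * emeasure P (- {x}) + ennreal t * emeasure Q (- {x}) = 0" .
  then have "emeasure P (- {x}) = 0" "emeasure Q (- {x}) = 0"
    using t by simp_all
  then have "AE y in P. y = x" "AE y in Q. y = x"
    using P Q by (auto intro!: AE_I[of _ _ "- {x}"] simp: borel_probsD)
  then show "P = return borel x" "Q = return borel x"
    using P Q by (blast intro: AE_return_imp_eq_return)+
qed

lemma uniform_measure_borel_probs:
  assumes "M \<in> borel_probs" "B \<in> sets borel" "measure M B > 0"
  shows "uniform_measure M B \<in> borel_probs"
proof -
  interpret prob_space M using assms(1) by (simp add: borel_probsD)
  have "prob_space (uniform_measure M B)"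
    using assms(3) by (intro prob_space_uniform_measure) (simp_all add: emeasure_eq_measure)
  then show ?thesis using assms(1) by (simp add: borel_probs_def)
qed

text \<open>The law of total probability. The parameter is \<open>1 - measure M B\<close> because
  the weight \<open>t\<close> belongs to the second component, here the complement of
  \<open>B\<close>.\<close>

lemma mixture_of_uniform_measures:
  assumes M: "M \<in> borel_probs" and B: "B \<in> sets borel" and p: "0 < measure M B" "measure M B < 1"
  shows "mixture_of M (1 - measure M B) (uniform_measure M B) (uniform_measure M (- B))"
proof -
  interpret prob_space M using M by (simp add: borel_probsD)
  note [simp] = borel_probsD(3,4)[OF M]
  have cB: "- B \<in> sets borel" "measure M (- B) = 1 - measure M B"
    using B prob_compl[of B] by (auto simp: Compl_eq_Diff_UNIV)
  have split: "measure M A = measure M (B \<inter> A) + measure M (- B \<inter> A)" if "A \<in> sets borel" for A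
    using that B cB by (subst finite_measure_Union[symmetric]) (auto intro!: arg_cong[where f="measure M"])
  have "measure M A = (1 - (1 - measure M B)) * measure (uniform_measure M B) A
      + (1 - measure M B) * measure (uniform_measure M (- B)) A" if A: "A \<in> sets borel" for A
  proof -
    have "measure (uniform_measure M B) A = measure M (B \<inter> A) / measure M B"
      "measure (uniform_measure M (- B)) A = measure M (- B \<inter> A) / (1 - measure M B)"
      using A B cB p by (simp_all add: measure_uniform_measure emeasure_eq_measure)
    then show ?thesis using split[OF A] p by simp
  qed
  moreover have "uniform_measure M B \<in> borel_probs" "uniform_measure M (- B) \<in> borel_probs"
    using B cB p by (auto intro: uniform_measure_borel_probs[OF M])
  ultimately show ?thesis
    using M p by (subst mixture_of_iff_measure) auto
qed

lemma solutions_borel_probs: "L \<in> solutions \<mu> \<phi> \<Longrightarrow> L k \<in> borel_probs"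
  unfolding solutions_def by blast

section \<open>Translates of solutions\<close>

context
  fixes \<phi> :: "'a::ordered_euclidean_space \<Rightarrow> 'a"
  assumes lin: "linear \<phi>" and bij: "bij \<phi>"
begin

abbreviation (input) translate :: "(int \<Rightarrow> 'a measure) \<Rightarrow> 'a measure \<Rightarrow> int \<Rightarrow> 'a measure" where
  "translate L \<nu> \<equiv> (\<lambda>k. L k \<star> distr \<nu> borel (int_iterate \<phi> k))"

lemma \<phi>_measurable: "\<phi> \<in> borel_measurable borel"
  by (rule linear_borel_measurable[OF lin])

lemma iterate_measurable: "int_iterate \<phi> k \<in> borel_measurable borel"
  by (intro linear_borel_measurable linear_int_iterate lin bij)

lemma distr_iterate_borel_probs: "M \<in> borel_probs \<Longrightarrow> distr M borel (int_iterate \<phi> k) \<in> borel_probs"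
  by (rule distr_borel_probs[OF _ iterate_measurable])

lemma distr_iterate_convolution:
  "M \<in> borel_probs \<Longrightarrow> N \<in> borel_probs \<Longrightarrow> distr (M \<star> N) borel (int_iterate \<phi> k) =
    (distr M borel (int_iterate \<phi> k) \<star> distr N borel (int_iterate \<phi> k))"
  by (intro distr_convolution_linear linear_int_iterate lin bij)

lemma distr_iterate_step:
  assumes "M \<in> borel_probs"
  shows "distr M borel (int_iterate \<phi> k) = distr (distr M borel (int_iterate \<phi> (k - 1))) borel \<phi>"
  using int_iterate_plus_1(1)[OF bij, of "k - 1"]
  by (simp add: distr_borel_probs_distr[OF assms iterate_measurable \<phi>_measurable])

lemmas bp_simps = return_borel_probs convolution_borel_probs distr_iterate_borel_probs
  solutions_borel_probs

lemma translate_translate: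
  assumes "L k \<in> borel_probs" "\<nu> \<in> borel_probs" "\<rho> \<in> borel_probs"
  shows "translate (translate L \<nu>) \<rho> k = translate L (\<nu> \<star> \<rho>) k"
  using assms by (simp add: distr_iterate_convolution borel_probs_assoc distr_iterate_borel_probs)

lemma translate_mixture:
  assumes "F \<in> solutions \<mu> \<phi>" "M \<in> borel_probs" "P \<in> borel_probs" "Q \<in> borel_probs" "mixture_of M t P Q"
  shows "mixture_of (translate F M k) t (translate F P k) (translate F Q k)"
  using assms
  by (intro mixture_of_convolution mixture_of_distr iterate_measurable) (simp_all add: bp_simps)

text \<open>A convex combination of solutions lifts to their parameters: with \<open>P\<close> and
  \<open>Q\<close> the translates of \<open>L\<close> by \<open>p\<close> and \<open>q\<close>, the
  mixture \<open>m\<close> of \<open>p\<close> and \<open>q\<close> translates \<open>L\<close> to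
  itself. Hence \<open>m\<close> is the point mass at 0, and that is extreme.\<close>

lemma fundamental_imp_extremal:
  assumes L: "fundamental_solution \<mu> \<phi> L"
  shows "extremal_solution \<mu> \<phi> L"
  unfolding extremal_solution_def
proof (intro conjI ballI allI impI)
  show L': "L \<in> solutions \<mu> \<phi>" using L by (simp add: fundamental_solution_def)
  fix P Q t assume P: "P \<in> solutions \<mu> \<phi>" and Q: "Q \<in> solutions \<mu> \<phi>"
    and "0 < t \<and> t < 1 \<and> convex_comb_of L t P Q"
  then have t: "0 < t" "t < 1" and comb: "convex_comb_of L t P Q" by simp_all
  obtain p where p: "p \<in> borel_probs" "\<And>k. P k = translate L p k"
    using L P by (auto simp: fundamental_solution_def)
  obtain q where q: "q \<in> borel_probs" "\<And>k. Q k = translate L q k"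
    using L Q by (auto simp: fundamental_solution_def)
  obtain m where m: "m \<in> borel_probs" "mixture_of m t p q"
    using mixture_exists[OF p(1) q(1), of t] t by auto
  \<comment> \<open>Coordinate 0 suffices, as \<open>int_iterate \<phi> 0\<close> is the identity
    and the parameter appears there undistorted.\<close>
  have "mixture_of (L 0) t (P 0) (Q 0)"
    using comb t L' P Q by (subst mixture_of_iff_measure) (auto simp: convex_comb_of_def bp_simps)
  moreover have "mixture_of (translate L m 0) t (P 0) (Q 0)"
    unfolding p(2) q(2) by (rule translate_mixture[OF L' m(1) p(1) q(1) m(2)])
  ultimately have "L 0 = (L 0 \<star> m)"
    using L' m(1) mixture_of_unique[of "L 0" "L 0 \<star> m" t "P 0" "Q 0"]
    by (simp add: bp_simps distr_borel_probs_id)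
  then have "m = return borel 0"
    using L' m(1) by (intro convolution_eq_self_imp[of "L 0"]) (simp_all add: bp_simps)
  then have "p = return borel 0" "q = return borel 0"
    using mixture_of_return_imp[OF p(1) q(1) _ t] m(2) by simp_all
  then show "P = Q" using p(2) q(2) by auto
qed

text \<open>Undoing the shift by \<open>y\<close> in coordinate 0 leaves \<open>L 0\<close> fixed by
  the point mass at \<open>x - y\<close>, which must then sit at 0.\<close>

lemma inj_translate:
  assumes L: "L \<in> solutions \<mu> \<phi>"
  shows "inj (\<lambda>x. translate L (return borel x))"
proof (rule injI)
  fix x y assume eq: "translate L (return borel x) = translate L (return borel y)"
  note L0 = solutions_borel_probs[OF L, of 0]
  have "(L 0 \<star> return borel x) = (L 0 \<star> return borel y)"
    using fun_cong[OF eq, of 0] by (simp add: distr_borel_probs_id return_borel_probs)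
  then have "((L 0 \<star> return borel x) \<star> return borel (- y)) = ((L 0 \<star> return borel y) \<star> return borel (- y))"
    by simp
  then have "(L 0 \<star> return borel (x - y)) = L 0"
    by (simp add: borel_probs_assoc L0 return_borel_probs return_convolution_return convolution_return_0)
  then have "return borel (x - y) = return borel 0"
    by (intro convolution_eq_self_imp[OF L0 return_borel_probs])
  then show "x = y" using return_borel_inject by fastforce
qed

context
  fixes \<mu> :: "int \<Rightarrow> 'a measure"
  assumes \<mu>: "\<And>k. \<mu> k \<in> borel_probs"
begin

text \<open>Coordinate \<open>k\<close> is transported by the inverse of the \<open>k\<close>-th
  iterate of \<open>\<phi>\<close>. This turns the equation into
  \<open>N k = \<sigma> k \<star> N (k - 1)\<close> and the translation by images of
  \<open>\<nu>\<close> into convolution with \<open>\<nu>\<close> itself; the result is transported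
  back.\<close>

lemma fundamental_solution_exists:
  assumes L: "L \<in> solutions \<mu> \<phi>"
  obtains F where "fundamental_solution \<mu> \<phi> F"
proof -
  define \<sigma> where "\<sigma> k = distr (\<mu> k) borel (int_iterate \<phi> (- k))" for k
  have \<sigma>: "\<sigma> k \<in> borel_probs" for k unfolding \<sigma>_def by (rule distr_iterate_borel_probs[OF \<mu>])
  define pull where "pull N k = distr (N k) borel (int_iterate \<phi> (- k))" for N :: "int \<Rightarrow> 'a measure" and k
  have pull: "pull N k \<in> borel_probs" "pull N k = (\<sigma> k \<star> pull N (k - 1))"
    "distr (pull N k) borel (int_iterate \<phi> k) = N k"
    if "N \<in> solutions \<mu> \<phi>" for N k
  proof -
    have N: "\<And>k. N k \<in> borel_probs" "\<And>k. N k = (\<mu> k \<star> distr (N (k - 1)) borel \<phi>)"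
      using that unfolding solutions_def by blast+
    show "pull N k \<in> borel_probs" unfolding pull_def by (rule distr_iterate_borel_probs[OF N(1)])
    have "pull N k = distr (\<mu> k \<star> distr (N (k - 1)) borel \<phi>) borel (int_iterate \<phi> (- k))"
      unfolding pull_def using N(2)[of k] by simp
    also have "\<dots> = (\<sigma> k \<star> distr (distr (N (k - 1)) borel \<phi>) borel (int_iterate \<phi> (- k)))"
      unfolding \<sigma>_def by (intro distr_iterate_convolution \<mu> distr_borel_probs N \<phi>_measurable)
    \<comment> \<open>The extra \<open>\<phi>\<close> raises the exponent \<open>- k\<close> to
      \<open>- k + 1 = - (k - 1)\<close>.\<close>
    also have "distr (distr (N (k - 1)) borel \<phi>) borel (int_iterate \<phi> (- k)) = pull N (k - 1)"
      unfolding pull_def using int_iterate_plus_1(2)[OF bij, of "- k"]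
      by (simp add: distr_borel_probs_distr[OF N(1) \<phi>_measurable iterate_measurable])
    finally show "pull N k = (\<sigma> k \<star> pull N (k - 1))" .
    show "distr (pull N k) borel (int_iterate \<phi> k) = N k"
      unfolding pull_def
      by (simp add: distr_borel_probs_distr[OF N(1) iterate_measurable iterate_measurable]
          int_iterate_minus[OF bij] distr_borel_probs_id N(1))
  qed
  obtain F where F: "\<And>k. F k \<in> borel_probs" "\<And>k. F k = (\<sigma> k \<star> F (k - 1))"
    and univ: "\<And>N. (\<And>k. N k \<in> borel_probs) \<Longrightarrow> (\<And>k. N k = (\<sigma> k \<star> N (k - 1))) \<Longrightarrow>
      \<exists>\<nu>\<in>borel_probs. \<forall>k. N k = (F k \<star> \<nu>)"
    by (rule fundamental_exists_id[of \<sigma> "pull L", OF \<sigma> pull(1,2)[OF L]]) blast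
  define G where "G k = distr (F k) borel (int_iterate \<phi> k)" for k
  have G: "G k \<in> borel_probs" for k unfolding G_def by (rule distr_iterate_borel_probs[OF F(1)])
  have G_eq: "G k = (\<mu> k \<star> distr (G (k - 1)) borel \<phi>)" for k
  proof -
    have "G k = distr (\<sigma> k \<star> F (k - 1)) borel (int_iterate \<phi> k)"
      unfolding G_def using F(2)[of k] by simp
    also have "\<dots> = (distr (\<sigma> k) borel (int_iterate \<phi> k) \<star> distr (F (k - 1)) borel (int_iterate \<phi> k))"
      by (rule distr_iterate_convolution[OF \<sigma> F(1)])
    also have "distr (\<sigma> k) borel (int_iterate \<phi> k) = \<mu> k"
      unfolding \<sigma>_def
      by (simp add: distr_borel_probs_distr[OF \<mu> iterate_measurable iterate_measurable]
          int_iterate_minus[OF bij] distr_borel_probs_id \<mu>)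
    also have "distr (F (k - 1)) borel (int_iterate \<phi> k) = distr (G (k - 1)) borel \<phi>"
      unfolding G_def by (rule distr_iterate_step[OF F(1)])
    finally show ?thesis .
  qed
  have "\<exists>\<nu>\<in>borel_probs. \<forall>k. N k = translate G \<nu> k" if N: "N \<in> solutions \<mu> \<phi>" for N
  proof -
    obtain \<nu> where \<nu>: "\<nu> \<in> borel_probs" "\<And>k. pull N k = (F k \<star> \<nu>)"
      using univ[of "pull N"] pull(1,2)[OF N] by blast
    have "N k = translate G \<nu> k" for k
      using pull(3)[OF N, of k] \<nu>(2)[of k] distr_iterate_convolution[OF F(1) \<nu>(1)] by (simp add: G_def)
    with \<nu>(1) show ?thesis by blast
  qed
  then have "fundamental_solution \<mu> \<phi> G"
    using G G_eq unfolding fundamental_solution_def solutions_def by blast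
  then show thesis by (rule that)
qed

lemma translate_solution:
  assumes L: "L \<in> solutions \<mu> \<phi>" and \<nu>: "\<nu> \<in> borel_probs"
  shows "translate L \<nu> \<in> solutions \<mu> \<phi>"
proof -
  note bp = solutions_borel_probs[OF L] distr_iterate_borel_probs[OF \<nu>]
  have "translate L \<nu> k = (\<mu> k \<star> distr (translate L \<nu> (k - 1)) borel \<phi>)" for k
  proof -
    have "L k = (\<mu> k \<star> distr (L (k - 1)) borel \<phi>)" using L unfolding solutions_def by blast
    then have "translate L \<nu> k =
        ((\<mu> k \<star> distr (L (k - 1)) borel \<phi>) \<star> distr (distr \<nu> borel (int_iterate \<phi> (k - 1))) borel \<phi>)"
      using distr_iterate_step[OF \<nu>, of k] by simp
    also have "\<dots> = (\<mu> k \<star> (distr (L (k - 1)) borel \<phi> \<star> distr (distr \<nu> borel (int_iterate \<phi> (k - 1))) borel \<phi>))"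
      by (intro borel_probs_assoc \<mu> distr_borel_probs bp \<phi>_measurable)
    also have "\<dots> = (\<mu> k \<star> distr (translate L \<nu> (k - 1)) borel \<phi>)"
      by (simp add: distr_convolution_linear[OF bp lin])
    finally show ?thesis .
  qed
  then show ?thesis
    using convolution_borel_probs[OF bp] unfolding solutions_def by blast
qed

text \<open>A shift by a point is invertible: a solution with parameter \<open>\<nu>\<close>
  relative to \<open>L\<close> has parameter \<open>\<nu>\<close> shifted by \<open>- x\<close>
  relative to the translate.\<close>

lemma translate_fundamental:
  assumes L: "fundamental_solution \<mu> \<phi> L"
  shows "fundamental_solution \<mu> \<phi> (translate L (return borel x))"
  unfolding fundamental_solution_def
proof (intro conjI ballI)
  have L': "L \<in> solutions \<mu> \<phi>" using L by (simp add: fundamental_solution_def)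
  show "translate L (return borel x) \<in> solutions \<mu> \<phi>"
    by (intro translate_solution L' return_borel_probs)
  fix N assume "N \<in> solutions \<mu> \<phi>"
  then obtain \<nu> where \<nu>: "\<nu> \<in> borel_probs" "\<And>k. N k = translate L \<nu> k"
    using L by (auto simp: fundamental_solution_def)
  define \<rho> where "\<rho> = (return borel (- x) \<star> \<nu>)"
  have \<rho>: "\<rho> \<in> borel_probs"
    unfolding \<rho>_def by (intro convolution_borel_probs return_borel_probs \<nu>)
  have "(return borel x \<star> \<rho>) = ((return borel x \<star> return borel (- x)) \<star> \<nu>)"
    unfolding \<rho>_def by (intro borel_probs_assoc[symmetric] return_borel_probs \<nu>)
  also have "\<dots> = \<nu>"
    using borel_probs_commute[OF \<nu>(1) return_borel_probs] convolution_return_0[OF \<nu>(1)]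
    by (simp add: return_convolution_return)
  finally have "N k = translate (translate L (return borel x)) \<rho> k" for k
    using translate_translate[of L k "return borel x" \<rho>, OF solutions_borel_probs[OF L'] return_borel_probs \<rho>] \<nu>(2)[of k] by simp
  with \<rho> show "\<exists>\<rho>\<in>borel_probs. \<forall>k. N k = translate (translate L (return borel x)) \<rho> k" by blast
qed

lemma extremal_eq_translate:
  assumes F: "fundamental_solution \<mu> \<phi> F" and L: "extremal_solution \<mu> \<phi> L"
  obtains x where "L = translate F (return borel x)"
proof -
  have F': "F \<in> solutions \<mu> \<phi>" using F by (simp add: fundamental_solution_def)
  have L': "L \<in> solutions \<mu> \<phi>" using L by (simp add: extremal_solution_def)
  obtain \<nu> where \<nu>: "\<nu> \<in> borel_probs" "\<And>k. L k = translate F \<nu> k"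
    using F L' by (auto simp: fundamental_solution_def)
  interpret prob_space \<nu> using \<nu>(1) by (simp add: borel_probsD)
  obtain x where x: "\<And>r. r > 0 \<Longrightarrow> measure \<nu> (cball x r) > 0"
    using support_point_exists[OF \<nu>(1)] by blast
  define u where "u n = uniform_measure \<nu> (cball x (1 / real (Suc n)))" for n
  have u: "u n \<in> borel_probs" for n
    unfolding u_def using \<nu>(1) x by (intro uniform_measure_borel_probs) simp_all
  have L_u: "L k = translate F (u n) k" for n k
  proof -
    let ?B = "cball x (1 / real (Suc n))"
    have B: "measure \<nu> ?B > 0" by (rule x) simp
    show ?thesis
    \<comment> \<open>A ball of full measure must be treated apart: its complement cannot be
      conditioned on, but conditioning on the ball changes nothing.\<close>
    proof (cases "measure \<nu> ?B = 1")
      case True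
      have "u n = \<nu>"
      proof (rule borel_probs_eqI[OF u \<nu>(1)])
        fix A :: "'a set" assume A: "A \<in> sets borel"
        have "AE y in \<nu>. y \<in> ?B" using True by (intro AE_prob_1) simp
        then have "emeasure \<nu> (?B \<inter> A) = emeasure \<nu> A"
          using A \<nu>(1) by (intro emeasure_eq_AE) (auto simp: borel_probsD)
        then show "emeasure (u n) A = emeasure \<nu> A"
          using A \<nu>(1) True by (simp add: u_def borel_probsD emeasure_eq_measure divide_ennreal[of _ 1, simplified])
      qed
      then show ?thesis using \<nu>(2) by simp
    next
      case False
      then have lt: "measure \<nu> ?B < 1" using prob_le_1[of ?B] by linarith
      have "measure \<nu> (- ?B) = 1 - measure \<nu> ?B"
        using prob_compl[of ?B] \<nu>(1) by (simp add: borel_probsD Compl_eq_Diff_UNIV)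
      then have v: "uniform_measure \<nu> (- ?B) \<in> borel_probs" (is "?v \<in> _")
        using lt \<nu>(1) by (intro uniform_measure_borel_probs) (auto intro: borel_comp)
      have mix: "mixture_of (L k) (1 - measure \<nu> ?B) (translate F (u n) k) (translate F ?v k)" for k
        unfolding \<nu>(2) u_def
        using B lt \<nu>(1) u[of n] v F'
        by (intro translate_mixture mixture_of_uniform_measures) (simp_all add: u_def)
      have sols: "translate F (u n) \<in> solutions \<mu> \<phi>" "translate F ?v \<in> solutions \<mu> \<phi>"
        by (intro translate_solution F' u v)+
      have "convex_comb_of L (1 - measure \<nu> ?B) (translate F (u n)) (translate F ?v)"
        unfolding convex_comb_of_def
      proof
        fix k
        show "\<forall>A\<in>sets borel. measure (L k) A = (1 - (1 - measure \<nu> ?B)) * measure (translate F (u n) k) A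
            + (1 - measure \<nu> ?B) * measure (translate F ?v k) A"
          using B lt L' sols
          by (intro mixture_of_iff_measure[THEN iffD1] mix) (auto intro: solutions_borel_probs)
      qed
      \<comment> \<open>Extremality identifies the two components, so \<open>L k\<close> is a
        mixture of one measure with itself.\<close>
      then have same: "translate F (u n) = translate F ?v"
        using L sols B lt unfolding extremal_solution_def by (meson diff_gt_0_iff_gt diff_less_eq less_add_same_cancel1)
      have "mixture_of (L k) (1 - measure \<nu> ?B) (translate F (u n) k) (translate F (u n) k)"
        using mix[of k] fun_cong[OF same, of k] by simp
      moreover have "mixture_of (translate F (u n) k) (1 - measure \<nu> ?B) (translate F (u n) k) (translate F (u n) k)"
        by (intro mixture_of_self) simp_all
      ultimately show ?thesis
        using mixture_of_unique solutions_borel_probs[OF L'] solutions_borel_probs[OF sols(1)] by blast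
    qed
  qed
  have "L k = translate F (return borel x) k" for k
  proof -
    let ?I = "int_iterate \<phi> k"
    have lin_I: "linear ?I" by (rule linear_int_iterate[OF lin bij])
    \<comment> \<open>An operator bound for the \<open>k\<close>-th iterate turns balls shrinking to
      \<open>x\<close> into sets shrinking to its image. It depends on \<open>k\<close>, so the
      limit is taken in each coordinate separately; \<open>\<bar>K\<bar>\<close> is used below
      because \<open>K\<close> is not known to be nonnegative.\<close>
    obtain K where K: "\<And>y. norm (?I y) \<le> norm y * K"
      using lin_I by (metis bounded_linear.bounded linear_conv_bounded_linear)
    have B: "distr (u n) borel ?I \<in> borel_probs" for n by (rule distr_iterate_borel_probs[OF u])
    have close: "AE z in distr (u n) borel ?I. dist z (?I x) \<le> 1 / real (Suc n) * \<bar>K\<bar>" for n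
    proof -
      have "AE y in u n. y \<in> cball x (1 / real (Suc n))"
        unfolding u_def by (rule AE_uniform_measureI) (use \<nu>(1) in \<open>simp_all add: borel_probsD\<close>)
      then have "AE y in u n. dist (?I y) (?I x) \<le> 1 / real (Suc n) * \<bar>K\<bar>"
      proof eventually_elim
        case (elim y)
        have "dist (?I y) (?I x) = norm (?I (y - x))" by (simp add: dist_norm linear_diff[OF lin_I])
        also have "\<dots> \<le> norm (y - x) * K" by (rule K)
        also have "\<dots> \<le> norm (y - x) * \<bar>K\<bar>" by (intro mult_left_mono) simp_all
        also have "\<dots> \<le> 1 / real (Suc n) * \<bar>K\<bar>"
          using elim by (intro mult_right_mono) (simp_all add: dist_norm norm_minus_commute)
        finally show ?case .
      qed
      then show ?thesis
        using iterate_measurable[of k] measurable_cong_sets[OF borel_probsD(3)[OF u[of n]] refl]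
        by (subst AE_distr_iff) auto
    qed
    have d: "(\<lambda>n. 1 / real (Suc n) * \<bar>K\<bar>) \<longlonglongrightarrow> 0"
      using tendsto_mult_left_zero[OF LIMSEQ_Suc[OF lim_1_over_n], of "\<bar>K\<bar>"] by simp
    note lims = concentrating_tight_weak_lim[OF B close d]
    have "L k = (F k \<star> return borel (?I x))"
    proof (rule weak_lim_convolution_unique)
      show "tight_seq (\<lambda>_. F k)" by (rule tight_seq_const[OF solutions_borel_probs[OF F']])
      show "weak_lim (\<lambda>_. F k) (F k)" "weak_lim (\<lambda>_. L k) (L k)"
        by (rule weak_lim_eventually_const, simp)+
      show "tight_seq (\<lambda>n. distr (u n) borel ?I)" "weak_lim (\<lambda>n. distr (u n) borel ?I) (return borel (?I x))"
        by (rule lims)+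
      show "\<forall>\<^sub>F n in sequentially. L k = (F k \<star> distr (u n) borel ?I)" using L_u by simp
    qed (simp_all add: bp_simps F' L' solutions_borel_probs[OF F'] solutions_borel_probs[OF L'])
    then show ?thesis by (simp add: distr_return_borel iterate_measurable)
  qed
  then show thesis by (intro that) auto
qed

lemma extremal_imp_fundamental:
  assumes "extremal_solution \<mu> \<phi> L"
  shows "fundamental_solution \<mu> \<phi> L"
proof -
  have "L \<in> solutions \<mu> \<phi>" using assms by (simp add: extremal_solution_def)
  then obtain F where F: "fundamental_solution \<mu> \<phi> F"
    by (rule fundamental_solution_exists)
  obtain x where "L = translate F (return borel x)"
    by (rule extremal_eq_translate[OF F assms])
  then show ?thesis using translate_fundamental[OF F] by simp
qed

end

end

theorem theorem1p2:
  fixes \<mu> :: "int \<Rightarrow> (real ^ 'd) measure"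
    and \<phi> :: "real ^ 'd \<Rightarrow> real ^ 'd"
  assumes "\<And>k. \<mu> k \<in> borel_probs"
    and "linear \<phi>" and "bij \<phi>"
  shows "(\<forall>L. fundamental_solution \<mu> \<phi> L \<longleftrightarrow> extremal_solution \<mu> \<phi> L) \<and>
    ({L. extremal_solution \<mu> \<phi> L} = {} \<or>
     (\<exists>L. extremal_solution \<mu> \<phi> L \<and>
        bij_betw (\<lambda>x k. L k \<star> distr (return borel x) borel (int_iterate \<phi> k))
          UNIV {L'. extremal_solution \<mu> \<phi> L'}))"
proof -
  have iff: "fundamental_solution \<mu> \<phi> L \<longleftrightarrow> extremal_solution \<mu> \<phi> L" for L
    using fundamental_imp_extremal[OF assms(2,3)] extremal_imp_fundamental[of \<phi> \<mu>, OF assms(2,3,1)] by blast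
  \<comment> \<open>The identification with the space requires choosing an origin, and any extremal
    solution will do.\<close>
  moreover have "bij_betw (\<lambda>x k. L k \<star> distr (return borel x) borel (int_iterate \<phi> k))
      UNIV {L'. extremal_solution \<mu> \<phi> L'}" if L: "extremal_solution \<mu> \<phi> L" for L
    unfolding bij_betw_def
  proof
    have F: "fundamental_solution \<mu> \<phi> L" using L iff by simp
    show "inj (\<lambda>x k. L k \<star> distr (return borel x) borel (int_iterate \<phi> k))"
      using L by (intro inj_translate[OF assms(2,3), of L \<mu>]) (simp add: extremal_solution_def)
    show "range (\<lambda>x k. L k \<star> distr (return borel x) borel (int_iterate \<phi> k)) = {L'. extremal_solution \<mu> \<phi> L'}"
    proof (intro equalityI subsetI)
      fix L' assume "L' \<in> range (\<lambda>x k. L k \<star> distr (return borel x) borel (int_iterate \<phi> k))"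
      then show "L' \<in> {L'. extremal_solution \<mu> \<phi> L'}"
        using translate_fundamental[of \<phi> \<mu>, OF assms(2,3,1) F] iff by auto
    next
      fix L' assume "L' \<in> {L'. extremal_solution \<mu> \<phi> L'}"
      then obtain x where "L' = (\<lambda>k. L k \<star> distr (return borel x) borel (int_iterate \<phi> k))"
        using extremal_eq_translate[of \<phi> \<mu>, OF assms(2,3,1) F] by blast
      then show "L' \<in> range (\<lambda>x k. L k \<star> distr (return borel x) borel (int_iterate \<phi> k))" by blast
    qed
  qed
  ultimately show ?thesis by blast
qed

end
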